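(* Let $\sigma>0$ and let $\phi(z)=z+b$ where $b\in\mathbb{C}$. Let $(k_w)_{w\in\mathbb{C}}$ be the reproducing kernels of the Paley-Wiener space $B^2_\sigma$, and let $C_\phi$ be the composition operator on $B^2_\sigma$ with symbol $\phi$. (1) If $b\in\mathbb{C}\setminus\mathbb{R}$, or if $b\in\mathbb{R}$ with $0<|b|<\pi/\sigma$, then for every $w\in\mathbb{C}$ the kernel $k_w$ is a cyclic vector for $C_\phi$. (2) If $b\in\mathbb{R}$ and $|b|=\pi/\sigma$, then for every $w\in\mathbb{C}$ the kernel $k_w$ is not a cyclic vector for $C_\phi$.
   Context: For $\sigma>0$, the Paley-Wiener space $B^2_\sigma$ is the Hilbert space of all entire functions of exponential type $\leq\sigma$ whose restrictions to $\mathbb{R}$ belong to $L^2(\mathbb{R})$, with norm $\|f\|^2=\int_{-\infty}^{\infty}|f(t)|^2\,dt$ (and corresponding inner product). It is a reproducing kernel Hilbert space; the reproducing kernel at $w\in\mathbb{C}$ is $k_w(z)=\frac{\sin\sigma(z-\overline{w})}{\pi(z-\overline{w})}$, $z\in\mathbb{C}$ (with the removable singularity at $z=\overline{w}$ filled in), and satisfies $\langle f,k_w\rangle=f(w)$ for all $f\in B^2_\sigma$. The composition operator is $C_\phi f=f\circ\phi$, which is bounded on $B^2_\sigma$ for $\phi(z)=z+b$, $b\in\mathbb{C}$. A vector $f$ in a Hilbert space $\mathcal{H}$ is a cyclic vector for a bounded operator $T$ on $\mathcal{H}$ if the linear span of $\{T^nf:n=0,1,2,\ldots\}$ is dense in $\mathcal{H}$.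 *)

theory Defs
  imports "HOL-Complex_Analysis.Complex_Analysis" "HOL-Probability.Sinc_Integral"
begin

text \<open>For entire functions the bound below amounts to
  \<open>limsup (ln M(r) / r) \<le> \<sigma>\<close> as \<open>r\<close> tends to infinity, with \<open>M(r)\<close> the maximum of
  \<open>norm (f z)\<close> over \<open>norm z = r\<close>.\<close>

definition exp_type_le :: "real \<Rightarrow> (complex \<Rightarrow> complex) \<Rightarrow> bool" where
  "exp_type_le \<sigma> f \<longleftrightarrow>
     (\<forall>\<epsilon>>0. \<exists>C. \<forall>z. norm (f z) \<le> C * exp ((\<sigma> + \<epsilon>) * norm z))"

definition paley_wiener :: "real \<Rightarrow> (complex \<Rightarrow> complex) set" where
  "paley_wiener \<sigma> = {f. f holomorphic_on UNIV \<and> exp_type_le \<sigma> f \<and>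
     integrable lborel (\<lambda>t. (norm (f (complex_of_real t)))\<^sup>2)}"

definition pw_norm :: "(complex \<Rightarrow> complex) \<Rightarrow> real" where
  "pw_norm f = sqrt (LINT t|lborel. (norm (f (complex_of_real t)))\<^sup>2)"

text \<open>The value at \<open>z = cnj w\<close> fills in the removable singularity.\<close>

definition pw_kernel :: "real \<Rightarrow> complex \<Rightarrow> complex \<Rightarrow> complex" where
  "pw_kernel \<sigma> w z =
     (if z = cnj w then of_real (\<sigma> / pi)
      else sin (of_real \<sigma> * (z - cnj w)) / (of_real pi * (z - cnj w)))"

definition comp_op :: "(complex \<Rightarrow> complex) \<Rightarrow> (complex \<Rightarrow> complex) \<Rightarrow> (complex \<Rightarrow> complex)" where
  "comp_op \<phi> f = f \<circ> \<phi>"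

text \<open>The complex linear span, written out because the function type has no complex vector
  space structure in the library.\<close>

definition fun_span :: "(complex \<Rightarrow> complex) set \<Rightarrow> (complex \<Rightarrow> complex) set" where
  "fun_span S = {(\<lambda>z. \<Sum>g\<in>F. c g * g z) | F c. finite F \<and> F \<subseteq> S}"

text \<open>\<open>T\<close> is meant to map the Paley-Wiener space into itself, so that \<open>h\<close> below lies in the space;
  lemma \<open>pw_orbit_kernel_mem\<close> confirms this for translations and reproducing kernels.\<close>

definition pw_cyclic ::
  "real \<Rightarrow> ((complex \<Rightarrow> complex) \<Rightarrow> (complex \<Rightarrow> complex)) \<Rightarrow> (complex \<Rightarrow> complex) \<Rightarrow> bool" where
  "pw_cyclic \<sigma> T f \<longleftrightarrow> f \<in> paley_wiener \<sigma> \<and>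
     (\<forall>g\<in>paley_wiener \<sigma>. \<forall>\<epsilon>>0. \<exists>h\<in>fun_span (range (\<lambda>n::nat. (T ^^ n) f)).
        pw_norm (\<lambda>z. g z - h z) < \<epsilon>)"

lemma norm_sin_le_exp: "norm (sin z) \<le> exp \<bar>Im z\<bar>" for z :: complex
  using cmod_sin_le_exp[of 1 z] by simp

lemma pw_kernel_holomorphic: "pw_kernel \<sigma> w holomorphic_on UNIV"
proof -
  define g where "g = (\<lambda>z. sin (of_real \<sigma> * (z - cnj w)) / of_real pi :: complex)"
  have hol: "g holomorphic_on UNIV"
    unfolding g_def by (intro holomorphic_intros) auto
  have "(g has_field_derivative of_real (\<sigma> / pi)) (at (cnj w))"
    unfolding g_def by (auto intro!: derivative_eq_intros)
  then have d: "deriv g (cnj w) = of_real (\<sigma> / pi)"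
    by (rule DERIV_imp_deriv)
  show ?thesis
    by (rule pole_theorem_open_0[OF hol open_UNIV, where a = "cnj w"])
       (auto simp: pw_kernel_def d, auto simp: g_def divide_simps)
qed

lemma pw_kernel_bounded_on_cball: "\<exists>B\<ge>0. \<forall>z. norm z \<le> r \<longrightarrow> norm (pw_kernel \<sigma> w z) \<le> B"
proof -
  have "continuous_on (cball 0 r) (pw_kernel \<sigma> w)"
    using holomorphic_on_imp_continuous_on[OF pw_kernel_holomorphic] continuous_on_subset by blast
  then have "bounded (pw_kernel \<sigma> w ` cball 0 r)"
    by (intro compact_imp_bounded compact_continuous_image compact_cball)
  then obtain B where "B > 0" "\<forall>x\<in>pw_kernel \<sigma> w ` cball 0 r. norm x \<le> B"
    using bounded_pos by blast
  then show ?thesis by (intro exI[of _ B]) auto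
qed

lemma pw_kernel_mem:
  assumes "\<sigma> > 0"
  shows "pw_kernel \<sigma> w \<in> paley_wiener \<sigma>"
proof -
  define K where "K = pw_kernel \<sigma> w"
  define R where "R = 1 + 2 * norm w"
  obtain B where B: "B \<ge> 0" "\<And>z. norm z \<le> R \<Longrightarrow> norm (K z) \<le> B"
    using pw_kernel_bounded_on_cball[of R \<sigma> w] unfolding K_def by blast
  have R: "R \<ge> 1" by (simp add: R_def)
  have far: "norm (K z) \<le> 2 * exp (\<sigma> * \<bar>Im (z - cnj w)\<bar>) / norm z" if "norm z > R" for z
  proof -
    have d: "norm (z - cnj w) \<ge> norm z / 2"
      using norm_triangle_ineq2[of z "cnj w"] that norm_ge_zero[of w] unfolding R_def
      by (simp del: norm_ge_zero)
    have z: "norm z > 0" using that R by linarith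
    have ne: "z \<noteq> cnj w" using d z by auto
    have pi1: "1 \<le> pi" using pi_gt3 by linarith
    have "norm z / 2 \<le> pi * norm (z - cnj w)"
      using d mult_right_mono[OF pi1, of "norm (z - cnj w)"] by simp
    moreover have "norm (sin (of_real \<sigma> * (z - cnj w))) \<le> exp (\<sigma> * \<bar>Im (z - cnj w)\<bar>)"
      using norm_sin_le_exp[of "of_real \<sigma> * (z - cnj w)"] assms by (simp add: abs_mult)
    moreover have "norm (K z) = norm (sin (of_real \<sigma> * (z - cnj w))) / (pi * norm (z - cnj w))"
      using ne by (simp add: K_def pw_kernel_def norm_divide norm_mult)
    ultimately have "norm (K z) \<le> exp (\<sigma> * \<bar>Im (z - cnj w)\<bar>) / (norm z / 2)"
      using z by (simp only:) (intro frac_le, auto)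
    then show ?thesis by (simp add: mult.commute)
  qed
  have "exp_type_le \<sigma> K"
    unfolding exp_type_le_def
  proof (intro allI impI)
    fix \<epsilon> :: real assume e: "\<epsilon> > 0"
    define C where "C = B + 2 * exp (\<sigma> * norm w)"
    have "norm (K z) \<le> C * exp ((\<sigma> + \<epsilon>) * norm z)" for z
    proof (cases "norm z \<le> R")
      case True
      have "C \<ge> 0" using B(1) by (simp add: C_def)
      then have "C * 1 \<le> C * exp ((\<sigma> + \<epsilon>) * norm z)"
        using assms e by (intro mult_left_mono) auto
      moreover have "B \<le> C" by (simp add: C_def)
      ultimately show ?thesis using B(2)[OF True] by linarith
    next
      case False
      have z: "norm z \<ge> 1" using False R by linarith
      have "\<bar>Im (z - cnj w)\<bar> \<le> norm w + norm z"
        using abs_Im_le_cmod[of z] abs_Im_le_cmod[of w] by simp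
      then have "\<sigma> * \<bar>Im (z - cnj w)\<bar> \<le> \<sigma> * (norm w + norm z)"
        using assms by (intro mult_left_mono) auto
      also have "\<dots> \<le> \<sigma> * norm w + (\<sigma> + \<epsilon>) * norm z"
        using e by (simp add: algebra_simps)
      finally have 1: "exp (\<sigma> * \<bar>Im (z - cnj w)\<bar>) \<le> exp (\<sigma> * norm w) * exp ((\<sigma> + \<epsilon>) * norm z)"
        by (simp flip: exp_add)
      have "norm (K z) \<le> 2 * exp (\<sigma> * \<bar>Im (z - cnj w)\<bar>) / norm z"
        using far[of z] False by auto
      also have "\<dots> \<le> 2 * exp (\<sigma> * \<bar>Im (z - cnj w)\<bar>) / 1"
        using z by (intro divide_left_mono) auto
      also have "\<dots> \<le> 2 * exp (\<sigma> * norm w) * exp ((\<sigma> + \<epsilon>) * norm z)"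
        using 1 by simp
      also have "\<dots> \<le> C * exp ((\<sigma> + \<epsilon>) * norm z)"
        using B(1) by (intro mult_right_mono) (auto simp: C_def)
      finally show ?thesis .
    qed
    then show "\<exists>C. \<forall>z. norm (K z) \<le> C * exp ((\<sigma> + \<epsilon>) * norm z)" by blast
  qed
  moreover have "integrable lborel (\<lambda>t. (norm (K (complex_of_real t)))\<^sup>2)"
  proof -
    define E where "E = exp (\<sigma> * \<bar>Im w\<bar>)"
    define D where "D = B\<^sup>2 * (1 + R\<^sup>2) + 8 * E\<^sup>2"
    have "integrable lborel (\<lambda>x::real. inverse (1 + x\<^sup>2))"
      using integrable_inverse_1_plus_square by (simp add: set_integrable_def)
    then have int: "integrable lborel (\<lambda>x::real. D * inverse (1 + x\<^sup>2))"
      by simp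
    have "continuous_on UNIV K"
      using holomorphic_on_imp_continuous_on[OF pw_kernel_holomorphic] unfolding K_def .
    then have cont: "continuous_on UNIV (\<lambda>t. K (complex_of_real t))"
      by (rule continuous_on_compose2[OF _ continuous_on_of_real_id]) simp
    have bd: "(norm (K (of_real t)))\<^sup>2 \<le> D * inverse (1 + t\<^sup>2)" for t :: real
    proof -
      have "(norm (K (of_real t)))\<^sup>2 * (1 + t\<^sup>2) \<le> D"
      proof (cases "\<bar>t\<bar> \<le> R")
        case True
        then have "t\<^sup>2 \<le> R\<^sup>2" using abs_le_square_iff[of t R] R by simp
        moreover have "(norm (K (of_real t)))\<^sup>2 \<le> B\<^sup>2"
          using B(2)[of "of_real t"] True by (intro power_mono) auto
        ultimately have "(norm (K (of_real t)))\<^sup>2 * (1 + t\<^sup>2) \<le> B\<^sup>2 * (1 + R\<^sup>2)"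
          by (intro mult_mono) auto
        then show ?thesis by (simp add: D_def add_increasing2)
      next
        case False
        then have t: "\<bar>t\<bar> > R" by simp
        then have t1: "t\<^sup>2 \<ge> 1" using abs_le_square_iff[of 1 t] R by simp
        have "norm (K (of_real t)) \<le> 2 * E / \<bar>t\<bar>"
          using far[of "of_real t"] t by (simp add: E_def)
        then have "(norm (K (of_real t)))\<^sup>2 \<le> (2 * E / \<bar>t\<bar>)\<^sup>2"
          by (intro power_mono) auto
        also have "\<dots> = 4 * E\<^sup>2 / t\<^sup>2" by (simp add: power_divide power_mult_distrib)
        finally have "(norm (K (of_real t)))\<^sup>2 * (1 + t\<^sup>2) \<le> (4 * E\<^sup>2 / t\<^sup>2) * (2 * t\<^sup>2)"
          using t1 by (intro mult_mono) auto
        also have "\<dots> = 8 * E\<^sup>2" using t1 by auto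
        also have "\<dots> \<le> D" by (simp add: D_def)
        finally show ?thesis .
      qed
      moreover have "1 + t\<^sup>2 > 0" by (simp add: add_pos_nonneg)
      ultimately show ?thesis by (simp add: field_simps)
    qed
    show ?thesis
    proof (rule Bochner_Integration.integrable_bound[OF int])
      show "(\<lambda>t. (norm (K (complex_of_real t)))\<^sup>2) \<in> borel_measurable lborel"
        using borel_measurable_continuous_onI[OF cont] by measurable
      show "AE x in lborel. norm ((norm (K (complex_of_real x)))\<^sup>2) \<le> norm (D * inverse (1 + x\<^sup>2))"
        using order_trans[OF bd abs_ge_self] by (intro AE_I2) (simp only: real_norm_def abs_power2)
    qed
  qed
  ultimately show ?thesis
    using pw_kernel_holomorphic[of \<sigma> w] by (simp add: paley_wiener_def K_def)
qed

lemma comp_op_translation_power: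
  "(comp_op (\<lambda>z. z + b) ^^ n) f = (\<lambda>z. f (z + of_nat n * b))"
  by (induction n) (auto simp: comp_op_def fun_eq_iff algebra_simps)

lemma pw_kernel_translate:
  "pw_kernel \<sigma> w (z + of_nat n * b) = pw_kernel \<sigma> (w - of_nat n * cnj b) z"
  by (auto simp: pw_kernel_def algebra_simps)

lemma pw_orbit_kernel_mem:
  assumes "\<sigma> > 0"
  shows "(comp_op (\<lambda>z. z + b) ^^ n) (pw_kernel \<sigma> w) \<in> paley_wiener \<sigma>"
  using pw_kernel_mem[OF assms, of "w - of_nat n * cnj b"]
  by (simp add: comp_op_translation_power pw_kernel_translate)

end

theory Submission
  imports Defs "HOL-Real_Asymp.Real_Asymp"
begin

text \<open>
  The iterates of the kernel at \<open>w\<close> under the translation operator are the kernels at the points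
  \<open>w - n * cnj b\<close>, so cyclicity asks whether the values of a Paley-Wiener function along this
  arithmetic progression determine it.

  Uniqueness along the progression.  A Paley-Wiener function \<open>f\<close> satisfies
  \<open>norm (f z) \<le> C * exp (\<sigma> * \<bar>Im z\<bar>)\<close> (\<open>pw_point_bound\<close>).  Put \<open>F \<zeta> = f (w - cnj b * \<zeta>)\<close>, which
  vanishes at the natural numbers.  If \<open>b\<close> is real with \<open>\<bar>b\<bar> < pi / \<sigma>\<close>, then \<open>F\<close> grows like
  \<open>exp (a * \<bar>Im \<zeta>\<bar>)\<close> with \<open>a < pi\<close>.  If \<open>b\<close> is not real, the progression leaves the real axis
  transversally, and after multiplication by a suitable exponential \<open>F\<close> is bounded in a tilted half
  plane that contains the positive axis in its interior.  In both cases \<open>F \<zeta> / sin (pi * \<zeta>)\<close> is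
  holomorphic in a half plane and decays exponentially along its boundary directions, which forces
  it to vanish (\<open>carlson_half_plane\<close>, a form of the theorem of Carlson).

  From uniqueness to density.  Let \<open>u n\<close> be the differences between a given \<open>g\<close> and elements of the span
  of the kernels that approach the minimal distance.  The parallelogram law makes them a Cauchy
  sequence, point evaluations are bounded, and so they converge locally uniformly to an entire
  function \<open>U\<close>.  Near-minimality together with the reproducing property (\<open>pw_reproducing\<close>) makes
  \<open>U\<close> vanish along the progression, so \<open>U = 0\<close>; the lemma of Fatou then gives that
  the minimal distance is \<open>0\<close> (\<open>kernel_progression_dense\<close>).

  The critical step.  If \<open>b\<close> is real with \<open>\<bar>b\<bar> = pi / \<sigma>\<close>, every kernel of the orbit vanishes at
  \<open>cnj w + b\<close>, the term that precedes the progression \<open>cnj w - n * b\<close> formed by the removable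
  singularities of these kernels (\<open>pw_kernel_critical_zero\<close>).  Point evaluation there is a bounded
  functional that kills the whole span but not the space.

  The pointwise bound rests on the Phragmen-Lindelof principle.  To pass from square integrability
  to boundedness, the principle is applied to the primitive of \<open>f\<^sup>2\<close>, which is bounded on the real
  line by \<open>(pw_norm f)\<^sup>2\<close>; the Cauchy estimate for the derivative then bounds \<open>f\<^sup>2\<close>.  The
  reproducing property follows from the pointwise bound by contour integration: the sine in the
  kernel is split into two exponentials, and each is treated in the half plane where its product
  with \<open>f\<close> is bounded.
\<close>

section \<open>Phragmen-Lindelof principles\<close>

text \<open>The maximum principle on an unbounded set: the hypothesis far out reduces it to a bounded one.\<close>

lemma max_modulus_closed:
  assumes "closed S" and cont: "continuous_on S f" and hol: "f holomorphic_on interior S"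
    and bdry: "\<And>z. z \<in> frontier S \<Longrightarrow> norm (f z) \<le> M"
    and far: "\<And>z. z \<in> S \<Longrightarrow> norm z \<ge> R \<Longrightarrow> norm (f z) \<le> M"
    and z: "z \<in> S"
  shows "norm (f z) \<le> M"
proof (cases "norm z \<ge> R")
  case True
  then show ?thesis using far z by blast
next
  case False
  define T where "T = S \<inter> cball 0 R"
  have cl: "closed T" unfolding T_def using assms(1) by auto
  have intT: "interior T = interior S \<inter> ball 0 R" by (simp add: T_def interior_cball)
  show ?thesis
  proof (rule maximum_modulus_frontier[of f T])
    show "f holomorphic_on interior T" using hol intT by (auto intro: holomorphic_on_subset)
    show "continuous_on (closure T) f"
      using cont cl by (auto simp: T_def intro: continuous_on_subset)
    show "bounded T" unfolding T_def by (simp add: bounded_Int)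
    show "z \<in> T" using z False by (simp add: T_def)
    fix x assume "x \<in> frontier T"
    then have x: "x \<in> S" "norm x \<le> R" "x \<notin> interior S \<or> norm x \<ge> R"
      using cl intT by (auto simp: frontier_def T_def)
    show "norm (f x) \<le> M"
    proof (cases "norm x \<ge> R")
      case True then show ?thesis using far x by blast
    next
      case False
      then have "x \<in> frontier S" using x assms(1) by (simp add: frontier_def)
      then show ?thesis using bdry by blast
    qed
  qed
qed

text \<open>A sector around the positive axis with opening less than \<open>pi\<close> stays inside the right half plane
  under \<open>z \<mapsto> z powr \<beta>\<close> for some \<open>\<beta> > 1\<close>.  This produces the damping factor below, which beats
  functions of order one.\<close>

lemma sector_powr_bound:
  assumes "k > 0"
  obtains \<beta> \<gamma> where "\<beta> > 1" "\<gamma> > 0"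
    "\<And>z. Re z > 0 \<Longrightarrow> \<bar>Im z\<bar> \<le> k * Re z \<Longrightarrow> Re (z powr of_real \<beta>) \<ge> \<gamma> * norm z powr \<beta>"
proof -
  define \<alpha> where "\<alpha> = arctan k"
  have a: "0 < \<alpha>" "\<alpha> < pi/2" using assms arctan_ubound[of k] by (auto simp: \<alpha>_def)
  \<comment> \<open>The mean of \<open>1\<close> and the critical exponent, at which the sector would fill the half plane.\<close>
  define \<beta> where "\<beta> = (1 + pi/2/\<alpha>) / 2"
  have b1: "\<beta> > 1" using a by (simp add: \<beta>_def field_simps)
  have "\<beta> * \<alpha> = (\<alpha> + pi/2)/2" using a by (simp add: \<beta>_def field_simps)
  then have b2: "\<beta> * \<alpha> < pi/2" "0 < \<beta> * \<alpha>" using a by auto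
  define \<gamma> where "\<gamma> = cos (\<beta> * \<alpha>)"
  have g: "\<gamma> > 0" unfolding \<gamma>_def using b2 by (intro cos_gt_zero) auto
  have "Re (z powr of_real \<beta>) \<ge> \<gamma> * norm z powr \<beta>"
    if z: "Re z > 0" "\<bar>Im z\<bar> \<le> k * Re z" for z
  proof -
    have z0: "z \<noteq> 0" using z by auto
    have arg: "Arg z = arctan (Im z / Re z)" using z(1) by (rule arg_conv_arctan)
    have "\<bar>Im z / Re z\<bar> \<le> k" using z by (simp add: field_simps abs_divide)
    then have "\<bar>Arg z\<bar> \<le> \<alpha>" unfolding arg \<alpha>_def
      by (metis abs_le_iff arctan_le_iff arctan_minus)
    then have "\<bar>\<beta> * Arg z\<bar> \<le> \<beta> * \<alpha>" using b1 by (simp add: abs_mult)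
    then have "cos \<bar>\<beta> * Arg z\<bar> \<ge> \<gamma>" unfolding \<gamma>_def
      using b2 pi_gt_zero by (intro cos_monotone_0_pi_le) auto
    then have c: "cos (\<beta> * Arg z) \<ge> \<gamma>" by simp
    have "Re (z powr of_real \<beta>) = norm z powr \<beta> * cos (\<beta> * Arg z)"
      using z0 by (simp add: powr_def Re_exp Arg_def)
    then show ?thesis using mult_left_mono[OF c, of "norm z powr \<beta>"] by (simp add: mult.commute)
  qed
  then show ?thesis using that b1 g by blast
qed

text \<open>The factor \<open>exp (- \<epsilon> * (z + 1) powr \<beta>)\<close> has modulus at most \<open>1\<close> in the sector and decays
  faster there than \<open>exp (B * norm z)\<close> grows, so that the maximum principle applies to the product;
  then \<open>\<epsilon>\<close> tends to \<open>0\<close>.  The shift by \<open>1\<close> moves the branch point out of the closed sector.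
  The bound \<open>M + \<delta>\<close> allows for \<open>M = 0\<close>.\<close>

lemma phragmen_lindelof_sector:
  fixes H :: "complex \<Rightarrow> complex"
  assumes "k > 0" and sub: "{z. \<bar>Im z\<bar> \<le> k * Re z} \<subseteq> U" and hol: "H holomorphic_on U"
    and growth: "\<And>z. \<bar>Im z\<bar> \<le> k * Re z \<Longrightarrow> norm (H z) \<le> A * exp (B * norm z)"
    and bdry: "\<And>z. \<bar>Im z\<bar> = k * Re z \<Longrightarrow> norm (H z) \<le> M"
    and z: "\<bar>Im z\<bar> \<le> k * Re z"
  shows "norm (H z) \<le> M"
proof -
  define S where "S = {z. \<bar>Im z\<bar> \<le> k * Re z}"
  have clS: "closed S" unfolding S_def by (intro closed_Collect_le continuous_intros)
  have "open {z. \<bar>Im z\<bar> < k * Re z}" by (intro open_Collect_less continuous_intros)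
  then have "{z. \<bar>Im z\<bar> < k * Re z} \<subseteq> interior S" by (intro interior_maximal) (auto simp: S_def)
  then have fr: "\<bar>Im z\<bar> = k * Re z" if "z \<in> frontier S" for z
    using that clS by (force simp: frontier_def S_def)
  have Re0: "Re z \<ge> 0" if "z \<in> S" for z
    using that assms(1) unfolding S_def by (smt (verit) mem_Collect_eq zero_le_mult_iff)
  obtain \<beta> \<gamma> where bg: "\<beta> > 1" "\<gamma> > 0"
    "\<And>z. Re z > 0 \<Longrightarrow> \<bar>Im z\<bar> \<le> k * Re z \<Longrightarrow> Re (z powr of_real \<beta>) \<ge> \<gamma> * norm z powr \<beta>"
    using sector_powr_bound[OF assms(1)] by blast
  have pw: "Re ((z+1) powr of_real \<beta>) \<ge> \<gamma> * norm (z+1) powr \<beta>" if "z \<in> S" for z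
    using bg(3)[of "z+1"] Re0[OF that] that assms(1) by (simp add: S_def algebra_simps)
  have M0: "M \<ge> 0" using order_trans[OF norm_ge_zero bdry[of 0]] by simp
  have main: "norm (H z * exp (- of_real \<epsilon> * (z+1) powr of_real \<beta>)) \<le> M + \<delta>"
    if e: "\<epsilon> > 0" and d: "\<delta> > 0" and z: "z \<in> S" for z \<epsilon> \<delta>
  proof -
    define P where "P = (\<lambda>z. H z * exp (- of_real \<epsilon> * (z+1) powr of_real \<beta>))"
    have nP: "norm (P z) = norm (H z) * exp (- \<epsilon> * Re ((z+1) powr of_real \<beta>))" for z
      by (simp add: P_def norm_mult)
    have le: "norm (P z) \<le> norm (H z) * exp (- \<epsilon> * (\<gamma> * norm (z+1) powr \<beta>))" if "z \<in> S" for z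
      unfolding nP using pw[OF that] e by (intro mult_left_mono) auto
    define V where "V = U \<inter> {z. Re z > -1}"
    have holP: "P holomorphic_on V"
      unfolding P_def V_def using hol
      by (intro holomorphic_intros) (auto intro: holomorphic_on_subset simp: complex_nonpos_Reals_iff)
    have SV: "S \<subseteq> V" using Re0 sub by (force simp: V_def S_def)
    have "((\<lambda>r. (\<bar>A\<bar>+1) * exp (B' * r - e' * (r - 1) powr \<beta>)) \<longlongrightarrow> 0) at_top"
      if "B' > 0" "e' > 0" for B' e' using bg(1) that by real_asymp
    from this[of "\<bar>B\<bar> + 1" "\<epsilon> * \<gamma>"] e bg(2)
    have lim: "((\<lambda>r. (\<bar>A\<bar>+1) * exp ((\<bar>B\<bar>+1) * r - \<epsilon> * \<gamma> * (r - 1) powr \<beta>)) \<longlongrightarrow> 0) at_top" by simp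
    then have "eventually (\<lambda>r. (\<bar>A\<bar>+1) * exp ((\<bar>B\<bar>+1) * r - \<epsilon> * \<gamma> * (r - 1) powr \<beta>) < \<delta>) at_top"
      using d by (intro order_tendstoD)
    then obtain R where R: "\<And>r. r \<ge> R \<Longrightarrow> (\<bar>A\<bar>+1) * exp ((\<bar>B\<bar>+1) * r - \<epsilon> * \<gamma> * (r - 1) powr \<beta>) < \<delta>"
      unfolding eventually_at_top_linorder by blast
    have "norm (P z) \<le> M + \<delta>"
    proof (rule max_modulus_closed[OF clS _ _ _ _ z])
      show "continuous_on S P" using holP SV holomorphic_on_imp_continuous_on holomorphic_on_subset by blast
      show "P holomorphic_on interior S" using holP SV interior_subset holomorphic_on_subset by blast
      show "norm (P z) \<le> M + \<delta>" if "z \<in> frontier S" for z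
      proof -
        have zS: "z \<in> S" using that clS by (simp add: frontier_def)
        have "norm (P z) \<le> norm (H z) * exp (- \<epsilon> * (\<gamma> * norm (z+1) powr \<beta>))" by (rule le[OF zS])
        also have "\<dots> \<le> norm (H z) * 1" using e bg(2) by (intro mult_left_mono) auto
        also have "\<dots> \<le> M + \<delta>" using bdry[OF fr[OF that]] d by simp
        finally show ?thesis .
      qed
      show "norm (P z) \<le> M + \<delta>" if zS: "z \<in> S" and zR: "norm z \<ge> max R 1" for z
      proof -
        define r where "r = norm z"
        have r: "r \<ge> R" "r \<ge> 1" using zR by (auto simp: r_def)
        have "r - 1 \<le> norm (z+1)" unfolding r_def using norm_triangle_ineq4[of "z+1" 1] by simp
        then have "(r - 1) powr \<beta> \<le> norm (z+1) powr \<beta>" using r bg(1) by (intro powr_mono2) auto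
        then have 1: "\<epsilon> * \<gamma> * (r - 1) powr \<beta> \<le> \<epsilon> * (\<gamma> * norm (z+1) powr \<beta>)" using e bg(2) by simp
        have "norm (H z) \<le> A * exp (B * r)" using growth[of z] zS by (simp add: S_def r_def)
        also have "\<dots> \<le> (\<bar>A\<bar>+1) * exp (B * r)" by (intro mult_right_mono) auto
        also have "\<dots> \<le> (\<bar>A\<bar>+1) * exp ((\<bar>B\<bar>+1) * r)" using r by (intro mult_left_mono) auto
        finally have 2: "norm (H z) \<le> (\<bar>A\<bar>+1) * exp ((\<bar>B\<bar>+1) * r)" .
        have "norm (P z) \<le> norm (H z) * exp (- \<epsilon> * (\<gamma> * norm (z+1) powr \<beta>))" by (rule le[OF zS])
        also have "\<dots> \<le> ((\<bar>A\<bar>+1) * exp ((\<bar>B\<bar>+1) * r)) * exp (- (\<epsilon> * \<gamma> * (r - 1) powr \<beta>))"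
          using 1 2 by (intro mult_mono) auto
        also have "\<dots> = (\<bar>A\<bar>+1) * exp ((\<bar>B\<bar>+1) * r - \<epsilon> * \<gamma> * (r - 1) powr \<beta>)"
          by (simp add: exp_diff exp_minus field_simps)
        also have "\<dots> \<le> M + \<delta>" using R[OF r(1)] M0 by simp
        finally show ?thesis .
      qed
    qed
    then show ?thesis by (simp add: P_def)
  qed
  have zS: "z \<in> S" using z by (simp add: S_def)
  show ?thesis
  proof (rule field_le_epsilon)
    fix \<delta> :: real assume d: "\<delta> > 0"
    have "((\<lambda>\<epsilon>. norm (H z * exp (- of_real \<epsilon> * (z+1) powr of_real \<beta>))) \<longlongrightarrow>
        norm (H z * exp (- of_real 0 * (z+1) powr of_real \<beta>))) (at_right 0)"
      by (intro tendsto_intros)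
    moreover have "eventually (\<lambda>\<epsilon>. norm (H z * exp (- of_real \<epsilon> * (z+1) powr of_real \<beta>)) \<le> M + \<delta>) (at_right 0)"
      using main[OF _ d zS] by (auto simp: eventually_at_right_field intro!: exI[of _ 1])
    ultimately show "norm (H z) \<le> M + \<delta>"
      by (intro tendsto_upperbound[of _ _ "at_right (0::real)"]) auto
  qed
qed

text \<open>For a bounded function, dividing by \<open>1 - \<i> * \<delta> * z\<close> is enough to obtain decay at infinity;
  in the upper half plane this denominator has modulus at least \<open>1\<close>.\<close>

lemma phragmen_lindelof_bounded_half_plane:
  assumes hol: "E holomorphic_on UNIV"
    and bd: "\<And>z. Im z \<ge> 0 \<Longrightarrow> norm (E z) \<le> B"
    and bdry: "\<And>x. norm (E (of_real x)) \<le> M"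
    and z: "Im z \<ge> 0"
  shows "norm (E z) \<le> M"
proof -
  define S where "S = {z. Im z \<ge> 0}"
  have clS: "closed S" unfolding S_def by (intro closed_Collect_le continuous_intros)
  have fr: "Im z = 0" if "z \<in> frontier S" for z
  proof -
    have "open {z. Im z > 0}" by (intro open_Collect_less continuous_intros)
    then have "{z. Im z > 0} \<subseteq> interior S" by (intro interior_maximal) (auto simp: S_def)
    then show ?thesis using that clS by (force simp: frontier_def S_def)
  qed
  have B0: "B \<ge> 0" using order_trans[OF norm_ge_zero bd[of 0]] by simp
  have M0: "M \<ge> 0" using order_trans[OF norm_ge_zero bdry[of 0]] by simp
  have re: "Re (1 - \<i> * of_real \<delta> * z) \<ge> 1" if "\<delta> > 0" "z \<in> S" for \<delta> z
    using that by (simp add: S_def)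
  then have ge1: "norm (1 - \<i> * of_real \<delta> * z) \<ge> 1" if "\<delta> > 0" "z \<in> S" for \<delta> z
    using that complex_Re_le_cmod order_trans by blast
  have main: "norm (E z / (1 - \<i> * of_real \<delta> * z)) \<le> M + e" if d: "\<delta> > 0" and e: "e > 0" and z: "z \<in> S" for \<delta> e z
  proof (rule max_modulus_closed[OF clS _ _ _ _ z])
    have ne: "1 - \<i> * of_real \<delta> * z \<noteq> 0" if "z \<in> S" for z using ge1[OF d that] by auto
    have h: "(\<lambda>z. E z / (1 - \<i> * of_real \<delta> * z)) holomorphic_on S"
      using ne by (intro holomorphic_intros holomorphic_on_subset[OF hol]) auto
    then show "continuous_on S (\<lambda>z. E z / (1 - \<i> * of_real \<delta> * z))" by (rule holomorphic_on_imp_continuous_on)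
    show "(\<lambda>z. E z / (1 - \<i> * of_real \<delta> * z)) holomorphic_on interior S"
      using h interior_subset holomorphic_on_subset by blast
    show "norm (E z / (1 - \<i> * of_real \<delta> * z)) \<le> M + e" if zf: "z \<in> frontier S" for z
    proof -
      have "z = of_real (Re z)" using fr[OF zf] by (simp add: complex_eq_iff)
      then have 1: "norm (E z) \<le> M" using bdry by metis
      have "z \<in> S" using zf clS by (simp add: frontier_def)
      then have "norm (E z) / norm (1 - \<i> * of_real \<delta> * z) \<le> M / 1"
        using ge1[OF d] 1 M0 by (intro frac_le) auto
      then show ?thesis using e by (simp add: norm_divide)
    qed
    show "norm (E z / (1 - \<i> * of_real \<delta> * z)) \<le> M + e" if zS: "z \<in> S" and zR: "norm z \<ge> (B/e + 1)/\<delta>" for z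
    proof -
      have "norm (1 - \<i> * of_real \<delta> * z) \<ge> \<delta> * norm z - 1"
        using norm_triangle_ineq2[of "\<i> * of_real \<delta> * z" 1] d by (simp add: norm_mult norm_minus_commute)
      then have 1: "norm (1 - \<i> * of_real \<delta> * z) \<ge> B/e" using zR d by (simp add: field_simps)
      then have "B \<le> e * norm (1 - \<i> * of_real \<delta> * z)" using e by (simp add: field_simps)
      moreover have "norm (E z) \<le> B" using bd zS by (simp add: S_def)
      ultimately have "norm (E z) \<le> e * norm (1 - \<i> * of_real \<delta> * z)" by simp
      then have "norm (E z / (1 - \<i> * of_real \<delta> * z)) \<le> e"
        using ge1[OF d zS] e by (simp add: norm_divide divide_le_eq)
      then show ?thesis using M0 by simp
    qed
  qed
  have zS: "z \<in> S" using z by (simp add: S_def)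
  show ?thesis
  proof (rule field_le_epsilon)
    fix e :: real assume e: "e > 0"
    have "((\<lambda>\<delta>. norm (E z / (1 - \<i> * of_real \<delta> * z))) \<longlongrightarrow> norm (E z / (1 - \<i> * of_real 0 * z))) (at_right 0)"
      by (intro tendsto_intros) auto
    moreover have "eventually (\<lambda>\<delta>. norm (E z / (1 - \<i> * of_real \<delta> * z)) \<le> M + e) (at_right 0)"
      using main[OF _ e zS] by (auto simp: eventually_at_right_field intro!: exI[of _ 1])
    ultimately show "norm (E z) \<le> M + e"
      by (intro tendsto_upperbound[of _ _ "at_right (0::real)"]) auto
  qed
qed

text \<open>Multiplication by \<open>exp (\<i> * (s + \<epsilon>) * z)\<close> compensates the growth along the imaginary axis.
  The sector principle in the two quadrants then gives a bound that depends on \<open>\<epsilon>\<close>; the half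
  plane principle replaces it by the bound \<open>M\<close> on the real line, after which \<open>\<epsilon>\<close> tends to \<open>0\<close>.\<close>

lemma exp_type_upper_half_plane_bound:
  assumes hol: "\<Psi> holomorphic_on UNIV" and et: "exp_type_le s \<Psi>"
    and bdry: "\<And>x. norm (\<Psi> (of_real x)) \<le> M"
    and z: "Im z \<ge> 0"
  shows "norm (\<Psi> z) \<le> M * exp (s * Im z)"
proof -
  have M0: "M \<ge> 0" using order_trans[OF norm_ge_zero bdry[of 0]] by simp
  have main: "norm (\<Psi> z) \<le> M * exp ((s + \<epsilon>) * Im z)" if e: "\<epsilon> > 0" for \<epsilon>
  proof -
    obtain C where C: "\<And>z. norm (\<Psi> z) \<le> C * exp ((s + \<epsilon>) * norm z)"
      using et e unfolding exp_type_le_def by blast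
    have C0: "C \<ge> 0" using order_trans[OF norm_ge_zero C[of 0]] by simp
    define E where "E = (\<lambda>z. \<Psi> z * exp (\<i> * of_real (s + \<epsilon>) * z))"
    have nE: "norm (E z) = norm (\<Psi> z) * exp (- (s + \<epsilon>) * Im z)" for z
      by (simp add: E_def norm_mult algebra_simps)
    have holE: "E holomorphic_on UNIV" unfolding E_def using hol by (intro holomorphic_intros)
    have Er: "norm (E (of_real x)) \<le> M" for x using bdry by (simp add: nE)
    have Ei: "norm (E (of_real y * \<i>)) \<le> C" if "y \<ge> 0" for y
    proof -
      have "norm (E (of_real y * \<i>)) \<le> (C * exp ((s + \<epsilon>) * y)) * exp (- (s + \<epsilon>) * y)"
        unfolding nE using C[of "of_real y * \<i>"] that by (simp add: norm_mult)
      also have "\<dots> = C" using exp_minus_inverse[of "(s + \<epsilon>) * y"] by (simp only: mult.assoc mult_minus_left mult_1_right)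
      finally show ?thesis .
    qed
    \<comment> \<open>The factors \<open>1 + \<i>\<close> and \<open>- 1 + \<i>\<close> rotate the sector of slope \<open>1\<close> onto the first and the second
      quadrant.\<close>
    have quad: "norm (E (a * z)) \<le> max M C" if a: "a = 1 + \<i> \<or> a = -1 + \<i>" and z: "\<bar>Im z\<bar> \<le> 1 * Re z" for a z
    proof (rule phragmen_lindelof_sector[where U=UNIV and k=1 and H="\<lambda>z. E (a*z)"
          and A = C and B = "(\<bar>s+\<epsilon>\<bar> + \<bar>s+\<epsilon>\<bar>) * norm a"])
      show "(\<lambda>z. E (a * z)) holomorphic_on UNIV"
        using holomorphic_on_compose_gen[OF holomorphic_on_mult[OF holomorphic_on_const holomorphic_on_ident] holE] by (simp add: o_def)
      show "norm (E (a * z)) \<le> C * exp ((\<bar>s+\<epsilon>\<bar> + \<bar>s+\<epsilon>\<bar>) * norm a * norm z)" for z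
      proof -
        have 1: "norm (\<Psi> (a*z)) \<le> C * exp (\<bar>s+\<epsilon>\<bar> * norm (a*z))"
          by (rule order_trans[OF C]) (use C0 in \<open>auto intro!: mult_left_mono mult_right_mono\<close>)
        have "- (s + \<epsilon>) * Im (a*z) \<le> \<bar>s+\<epsilon>\<bar> * \<bar>Im (a*z)\<bar>"
          by (metis abs_ge_self abs_minus abs_mult)
        also have "\<dots> \<le> \<bar>s+\<epsilon>\<bar> * norm (a*z)" by (intro mult_left_mono abs_Im_le_cmod) auto
        finally have 2: "exp (- (s + \<epsilon>) * Im (a*z)) \<le> exp (\<bar>s+\<epsilon>\<bar> * norm (a*z))" by simp
        have "norm (E (a * z)) \<le> (C * exp (\<bar>s+\<epsilon>\<bar> * norm (a*z))) * exp (\<bar>s+\<epsilon>\<bar> * norm (a*z))"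
          unfolding nE using 1 2 C0 by (intro mult_mono) auto
        also have "\<dots> = C * exp ((\<bar>s+\<epsilon>\<bar> + \<bar>s+\<epsilon>\<bar>) * norm a * norm z)"
          by (simp add: norm_mult algebra_simps flip: exp_add)
        finally show ?thesis .
      qed
      show "norm (E (a * z)) \<le> max M C" if zb: "\<bar>Im z\<bar> = 1 * Re z" for z
      proof -
        have "a * z = of_real (Re (a*z)) \<or> (a * z = of_real (Im (a*z)) * \<i> \<and> Im (a*z) \<ge> 0)"
          using a zb by (auto simp: complex_eq_iff)
        then show ?thesis using Er Ei by (metis max.coboundedI1 max.coboundedI2)
      qed
    qed (use z in auto)
    have bdd: "norm (E z) \<le> max M C" if z: "Im z \<ge> 0" for z
    proof (cases "Re z \<ge> 0")
      case True
      have "z = (1 + \<i>) * (((1 - \<i>)/2) * z)" by (simp add: complex_eq_iff field_simps)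
      moreover have "\<bar>Im (((1 - \<i>)/2) * z)\<bar> \<le> 1 * Re (((1 - \<i>)/2) * z)"
        using True z by (simp add: field_simps)
      ultimately show ?thesis using quad by metis
    next
      case False
      have "z = (-1 + \<i>) * (((- 1 - \<i>)/2) * z)" by (simp add: complex_eq_iff field_simps)
      moreover have "\<bar>Im (((- 1 - \<i>)/2) * z)\<bar> \<le> 1 * Re (((- 1 - \<i>)/2) * z)"
        using False z by (simp add: field_simps)
      ultimately show ?thesis using quad by metis
    qed
    have "norm (E z) \<le> M"
      by (rule phragmen_lindelof_bounded_half_plane[OF holE bdd Er z])
    then have "norm (\<Psi> z) * exp (- (s + \<epsilon>) * Im z) * exp ((s + \<epsilon>) * Im z) \<le> M * exp ((s + \<epsilon>) * Im z)"
      unfolding nE by (intro mult_right_mono) auto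
    moreover have "exp (- (s + \<epsilon>) * Im z) * exp ((s + \<epsilon>) * Im z) = 1"
      by (simp add: algebra_simps flip: exp_add)
    ultimately show ?thesis by (simp only: mult.assoc mult_1_right)
  qed
  have "((\<lambda>\<epsilon>. M * exp ((s + \<epsilon>) * Im z)) \<longlongrightarrow> M * exp ((s + 0) * Im z)) (at_right 0)"
    by (intro tendsto_intros)
  moreover have "eventually (\<lambda>\<epsilon>. norm (\<Psi> z) \<le> M * exp ((s + \<epsilon>) * Im z)) (at_right 0)"
    using main by (auto simp: eventually_at_right_field intro!: exI[of _ 1])
  ultimately show ?thesis
    by (intro tendsto_lowerbound[of "\<lambda>\<epsilon>. M * exp ((s + \<epsilon>) * Im z)" _ "at_right (0::real)"]) auto
qed

lemma exp_type_bounded_on_reals: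
  assumes hol: "\<Psi> holomorphic_on UNIV" and et: "exp_type_le s \<Psi>"
    and bdry: "\<And>x. norm (\<Psi> (of_real x)) \<le> M"
  shows "norm (\<Psi> z) \<le> M * exp (s * \<bar>Im z\<bar>)"
proof (cases "Im z \<ge> 0")
  case True
  then show ?thesis using exp_type_upper_half_plane_bound[OF assms, of z] by simp
next
  case False
  have "norm ((\<lambda>z. \<Psi> (- z)) (- z)) \<le> M * exp (s * Im (- z))"
  proof (rule exp_type_upper_half_plane_bound)
    show "(\<lambda>z. \<Psi> (- z)) holomorphic_on UNIV"
      using holomorphic_on_compose_gen[OF holomorphic_on_minus[OF holomorphic_on_ident] hol] by (simp add: o_def)
    show "exp_type_le s (\<lambda>z. \<Psi> (- z))"
      using et unfolding exp_type_le_def by (metis norm_minus_cancel)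
    show "norm (\<Psi> (- of_real x)) \<le> M" for x using bdry[of "-x"] by simp
    show "Im (- z) \<ge> 0" using False by simp
  qed
  then show ?thesis using False by simp
qed

section \<open>Point evaluation in the Paley-Wiener space\<close>

lemma paley_wienerD:
  assumes "f \<in> paley_wiener \<sigma>"
  shows "f holomorphic_on UNIV" "exp_type_le \<sigma> f" "integrable lborel (\<lambda>t. (norm (f (complex_of_real t)))\<^sup>2)"
    "continuous_on UNIV (\<lambda>t. f (complex_of_real t))" "(\<lambda>t. f (complex_of_real t)) \<in> borel_measurable lborel"
proof -
  show h: "f holomorphic_on UNIV" "exp_type_le \<sigma> f" "integrable lborel (\<lambda>t. (norm (f (complex_of_real t)))\<^sup>2)"
    using assms by (auto simp: paley_wiener_def)
  show c: "continuous_on UNIV (\<lambda>t. f (complex_of_real t))"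
    using continuous_on_compose2[OF holomorphic_on_imp_continuous_on[OF h(1)] continuous_on_of_real_id] by simp
  show "(\<lambda>t. f (complex_of_real t)) \<in> borel_measurable lborel"
    using borel_measurable_continuous_onI[OF c] by simp
qed

lemma pw_norm_sq: "(pw_norm f)\<^sup>2 = (LINT t|lborel. (norm (f (complex_of_real t)))\<^sup>2)"
  by (simp add: pw_norm_def)

lemma pw_norm_nonneg: "pw_norm f \<ge> 0"
  by (simp add: pw_norm_def)

lemma entire_primitive:
  fixes g :: "complex \<Rightarrow> complex"
  assumes "g holomorphic_on UNIV"
  obtains G where "\<And>z. (G has_field_derivative g z) (at z)" "G 0 = 0"
proof -
  obtain G where G: "\<And>z. (G has_field_derivative g z) (at z)"
    using holomorphic_convex_primitive'[OF convex_UNIV open_UNIV assms] by auto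
  show ?thesis
  proof (rule that)
    show "((\<lambda>z. G z - G 0) has_field_derivative g z) (at z)" for z
      using G[of z] by (auto intro!: derivative_eq_intros)
  qed simp
qed

text \<open>Integrability of \<open>\<bar>f\<bar>\<^sup>2\<close> is exactly what bounds the primitive of \<open>f\<^sup>2\<close> on the real line.\<close>

lemma primitive_square_real_bound:
  assumes f: "f \<in> paley_wiener \<sigma>" and G: "\<And>z. (G has_field_derivative (f z)\<^sup>2) (at z)" "G 0 = 0"
  shows "norm (G (of_real x)) \<le> (pw_norm f)\<^sup>2"
proof -
  define q where "q = (\<lambda>t. (norm (f (complex_of_real t)))\<^sup>2)"
  have q: "integrable lborel q" "continuous_on UNIV q"
    using paley_wienerD[OF f] unfolding q_def by (auto intro!: continuous_intros)
  have qint: "q integrable_on UNIV" "integral UNIV q = (pw_norm f)\<^sup>2"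
    using has_integral_integral_lborel[OF q(1)] unfolding pw_norm_sq q_def by (auto simp: integrable_on_def)
  have *: "norm (G (of_real b) - G (of_real a)) \<le> (pw_norm f)\<^sup>2" if "a \<le> b" for a b :: real
  proof -
    have d: "((\<lambda>t. G (of_real t)) has_vector_derivative (f (of_real t))\<^sup>2) (at t within {a..b})" for t
      using has_vector_derivative_real_field[OF G(1)[of "of_real t"], of "{a..b}"] by simp
    have i: "((\<lambda>t. (f (of_real t))\<^sup>2) has_integral (G (of_real b) - G (of_real a))) {a..b}"
      using d by (intro fundamental_theorem_of_calculus that)
    have qi: "q integrable_on {a..b}" using qint(1) integrable_on_subinterval by blast
    have "norm (G (of_real b) - G (of_real a)) = norm (integral {a..b} (\<lambda>t. (f (of_real t))\<^sup>2))"
      using i by (simp add: integral_unique)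
    also have "\<dots> \<le> integral {a..b} q"
      using i qi by (intro Henstock_Kurzweil_Integration.integral_norm_bound_integral)
        (auto simp: q_def norm_power)
    also have "\<dots> \<le> integral UNIV q"
      using qi qint(1) by (intro integral_subset_le) (auto simp: q_def)
    finally show ?thesis using qint(2) by simp
  qed
  show ?thesis using *[of 0 x] *[of x 0] G(2) by (cases "x \<ge> 0") (auto simp: norm_minus_commute)
qed

text \<open>Squaring doubles the type.  Integration from \<open>0\<close> to \<open>z\<close> costs only a factor \<open>norm z\<close>, which is
  absorbed into the \<open>\<epsilon>\<close> of the type; a quarter of \<open>\<epsilon>\<close> for \<open>f\<close> leaves room for it.\<close>

lemma primitive_square_exp_type:
  assumes f: "exp_type_le \<sigma> f" and G: "\<And>z. (G has_field_derivative (f z)\<^sup>2) (at z)" "G 0 = 0" and s: "\<sigma> > 0"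
  shows "exp_type_le (2 * \<sigma>) G"
  unfolding exp_type_le_def
proof (intro allI impI)
  fix \<epsilon> :: real assume e: "\<epsilon> > 0"
  obtain C where C: "\<And>z. norm (f z) \<le> C * exp ((\<sigma> + \<epsilon>/4) * norm z)"
    using f e unfolding exp_type_le_def by (metis divide_pos_pos zero_less_numeral)
  have "norm (G z) \<le> (C\<^sup>2 * (2/\<epsilon>)) * exp ((2*\<sigma>+\<epsilon>) * norm z)" for z
  proof -
    have b: "norm ((f y)\<^sup>2) \<le> C\<^sup>2 * exp ((2*\<sigma>+\<epsilon>/2) * norm z)" if "y \<in> cball 0 (norm z)" for y
    proof -
      have "norm ((f y)\<^sup>2) \<le> (C * exp ((\<sigma> + \<epsilon>/4) * norm y))\<^sup>2"
        unfolding norm_power by (intro power_mono C) auto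
      also have "\<dots> = C\<^sup>2 * exp ((2*\<sigma>+\<epsilon>/2) * norm y)"
        by (simp add: power_mult_distrib algebra_simps flip: exp_double)
      also have "\<dots> \<le> C\<^sup>2 * exp ((2*\<sigma>+\<epsilon>/2) * norm z)"
        using that s e by (intro mult_left_mono) auto
      finally show ?thesis .
    qed
    have "norm (G z - G 0) \<le> C\<^sup>2 * exp ((2*\<sigma>+\<epsilon>/2) * norm z) * norm (z - 0)"
      by (rule field_differentiable_bound[where S="cball 0 (norm z)"])
         (use b G in \<open>auto intro: has_field_derivative_at_within\<close>)
    also have "norm (z - 0) \<le> (2/\<epsilon>) * exp (\<epsilon>/2 * norm z)"
      using exp_ge_add_one_self[of "\<epsilon>/2 * norm z"] e by (simp add: field_simps)
    finally have "norm (G z) \<le> C\<^sup>2 * exp ((2*\<sigma>+\<epsilon>/2) * norm z) * ((2/\<epsilon>) * exp (\<epsilon>/2 * norm z))"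
      using G(2) by (simp add: mult_left_mono)
    also have "\<dots> = (C\<^sup>2 * (2/\<epsilon>)) * exp ((2*\<sigma>+\<epsilon>) * norm z)"
      by (simp add: algebra_simps flip: exp_add)
    finally show ?thesis .
  qed
  then show "\<exists>C. \<forall>z. norm (G z) \<le> C * exp ((2*\<sigma>+\<epsilon>) * norm z)" by blast
qed

text \<open>The primitive of \<open>f\<^sup>2\<close> is bounded on the real line, hence by \<open>exp (2 * \<sigma> * \<bar>Im z\<bar>)\<close>, up to a
  constant, everywhere.  The Cauchy estimate on a disc of radius \<open>1\<close> bounds its derivative \<open>f\<^sup>2\<close>,
  whence the summand \<open>1\<close> in the exponent.\<close>

lemma pw_point_bound:
  assumes s: "\<sigma> > 0" and f: "f \<in> paley_wiener \<sigma>"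
  shows "norm (f z) \<le> pw_norm f * exp (\<sigma> * (\<bar>Im z\<bar> + 1))"
proof -
  have "(\<lambda>z. (f z)\<^sup>2) holomorphic_on UNIV"
    using paley_wienerD(1)[OF f] by (intro holomorphic_intros)
  then obtain G where G: "\<And>z. (G has_field_derivative (f z)\<^sup>2) (at z)" "G 0 = 0"
    using entire_primitive by blast
  have holG: "G holomorphic_on UNIV" using G(1) by (auto simp: holomorphic_on_open)
  have Gb: "norm (G z) \<le> (pw_norm f)\<^sup>2 * exp (2 * \<sigma> * \<bar>Im z\<bar>)" for z
    by (rule exp_type_bounded_on_reals[OF holG primitive_square_exp_type[OF paley_wienerD(2)[OF f] G s]
          primitive_square_real_bound[OF f G]])
  have "norm ((deriv ^^ 1) G z) \<le> (fact 1) * ((pw_norm f)\<^sup>2 * exp (2 * \<sigma> * (\<bar>Im z\<bar> + 1))) / 1 ^ 1"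
  proof (rule Cauchy_inequality)
    show "G holomorphic_on ball z 1" using holG holomorphic_on_subset by blast
    show "continuous_on (cball z 1) G"
      using holomorphic_on_imp_continuous_on[OF holG] continuous_on_subset by blast
    show "norm (G x) \<le> (pw_norm f)\<^sup>2 * exp (2 * \<sigma> * (\<bar>Im z\<bar> + 1))" if "norm (z - x) = 1" for x
    proof -
      have "\<bar>Im x\<bar> \<le> \<bar>Im z\<bar> + 1" using abs_Im_le_cmod[of "z - x"] that by simp
      then have "(pw_norm f)\<^sup>2 * exp (2 * \<sigma> * \<bar>Im x\<bar>) \<le> (pw_norm f)\<^sup>2 * exp (2 * \<sigma> * (\<bar>Im z\<bar> + 1))"
        using s by (intro mult_left_mono) auto
      then show ?thesis using Gb[of x] by linarith
    qed
  qed auto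
  moreover have "deriv G z = (f z)\<^sup>2" using G(1) by (rule DERIV_imp_deriv)
  ultimately have "(norm (f z))\<^sup>2 \<le> (pw_norm f * exp (\<sigma> * (\<bar>Im z\<bar> + 1)))\<^sup>2"
    by (simp add: norm_power power_mult_distrib algebra_simps flip: exp_double)
  then show ?thesis by (rule power2_le_imp_le) (simp add: pw_norm_nonneg)
qed

section \<open>The reproducing property\<close>

lemma lborel_inverse_1_plus_square:
  "integrable lborel (\<lambda>x::real. inverse (1 + x\<^sup>2))" "(LINT x|lborel. inverse (1 + x\<^sup>2)) = pi"
  using integrable_inverse_1_plus_square LBINT_inverse_1_plus_square
  by (simp_all add: set_integrable_def interval_lebesgue_integral_def set_lebesgue_integral_def)

lemma lborel_integral_eq_limit:
  fixes f :: "real \<Rightarrow> complex"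
  assumes f: "integrable lborel f"
  shows "(\<lambda>n. integral {- real n..real n} f) \<longlonglongrightarrow> (LINT t|lborel. f t)"
proof -
  have "(\<lambda>n. LINT t|lborel. indicator {- real n..real n} t *\<^sub>R f t) \<longlonglongrightarrow> (LINT t|lborel. f t)"
  proof (rule integral_dominated_convergence[where w = "\<lambda>t. norm (f t)"])
    show "AE t in lborel. (\<lambda>n. indicator {- real n..real n} t *\<^sub>R f t) \<longlonglongrightarrow> f t"
    proof (intro AE_I2 tendsto_eventually)
      fix t :: real
      obtain N where "\<bar>t\<bar> \<le> real N" using real_arch_simple by blast
      then show "\<forall>\<^sub>F n in sequentially. indicator {- real n..real n} t *\<^sub>R f t = f t"
        unfolding eventually_sequentially by (intro exI[of _ N]) (auto simp: indicator_def)
    qed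
    show "AE t in lborel. norm (indicator {- real n..real n} t *\<^sub>R f t) \<le> norm (f t)" for n
      by (auto simp: indicator_def)
  qed (use f in auto)
  moreover have "(LINT t|lborel. indicator {- real n..real n} t *\<^sub>R f t) = integral {- real n..real n} f" for n
  proof -
    have "set_integrable lborel {- real n..real n} f"
      unfolding set_integrable_def by (rule integrable_mult_indicator[OF _ f]) simp
    from set_borel_integral_eq_integral(2)[OF this] show ?thesis by (simp add: set_lebesgue_integral_def)
  qed
  ultimately show ?thesis by simp
qed

text \<open>Close the segment from \<open>- R\<close> to \<open>R\<close> by a half circle; the decay makes its contribution vanish as
  \<open>R\<close> grows.\<close>

lemma real_line_integral_eq_0_quadratic_decay:
  assumes hol: "Q holomorphic_on {z. Im z > -1}"
    and dec: "\<And>z. Im z \<ge> 0 \<Longrightarrow> norm z \<ge> 1 \<Longrightarrow> norm (Q z) \<le> C / (norm z)\<^sup>2"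
    and int: "integrable lborel (\<lambda>t. Q (complex_of_real t))"
  shows "(LINT t|lborel. Q (complex_of_real t)) = 0"
proof -
  have b: "norm (integral {- real n..real n} (\<lambda>t. Q (complex_of_real t))) \<le> C * pi / real n" if n: "n \<ge> 1" for n :: nat
  proof -
    define R where "R = real n"
    have R: "R \<ge> 1" using n by (simp add: R_def)
    define \<gamma> where "\<gamma> = linepath (of_real (-R)) (of_real R) +++ part_circlepath 0 R 0 pi"
    have pi1: "path_image (linepath (of_real (-R)) (of_real R)) \<subseteq> {z. Im z > -1}"
      by (auto simp: in_segment)
    have pi2: "x \<in> path_image (part_circlepath 0 R 0 pi) \<Longrightarrow> norm x = R \<and> Im x \<ge> 0" for x
      using R pi_ge_zero by (auto simp: closed_segment_eq_real_ivl path_image_part_circlepath' in_path_image_part_circlepath norm_mult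
        intro!: mult_nonneg_nonneg sin_ge_zero simp flip: cis_conv_exp)
    have "(Q has_contour_integral 0) \<gamma>"
    proof (rule Cauchy_theorem_convex_simple[OF hol])
      show "convex {z. Im z > -1}" by (rule convex_halfspace_Im_gt)
      show "valid_path \<gamma>" unfolding \<gamma>_def by (intro valid_path_join) (auto simp: pathstart_part_circlepath)
      show "path_image \<gamma> \<subseteq> {z. Im z > -1}"
        unfolding \<gamma>_def using pi1 pi2 by (subst path_image_join) (force simp: pathstart_part_circlepath)+
      show "pathfinish \<gamma> = pathstart \<gamma>"
        by (simp add: \<gamma>_def pathfinish_part_circlepath exp_pi_i)
    qed
    moreover have c: "continuous_on {z. Im z > -1} Q" by (rule holomorphic_on_imp_continuous_on[OF hol])
    have i1: "Q contour_integrable_on linepath (of_real (-R)) (of_real R)"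
      using continuous_on_subset[OF c pi1] by (intro contour_integrable_continuous_linepath) simp
    have i2: "Q contour_integrable_on part_circlepath 0 R 0 pi"
      using pi2 by (intro contour_integrable_continuous_part_circlepath continuous_on_subset[OF c]) force
    ultimately have "contour_integral (linepath (of_real (-R)) (of_real R)) Q
        + contour_integral (part_circlepath 0 R 0 pi) Q = 0"
      unfolding \<gamma>_def using i1 i2
      by (subst contour_integral_join[symmetric]) (auto simp: pathstart_part_circlepath contour_integral_unique)
    then have "norm (contour_integral (linepath (of_real (-R)) (of_real R)) Q) = norm (contour_integral (part_circlepath 0 R 0 pi) Q)"
      by (metis add_eq_0_iff norm_minus_cancel)
    also have "\<dots> \<le> C / R\<^sup>2 * R * (pi - 0)"
    proof (rule has_contour_integral_bound_part_circlepath[OF has_contour_integral_integral[OF i2]])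
      show "norm (Q x) \<le> C / R\<^sup>2" if "x \<in> path_image (part_circlepath 0 R 0 pi)" for x
        using dec[of x] pi2[OF that] R by auto
      from this[of "of_real R"] show "0 \<le> C / R\<^sup>2"
        using dec[of "of_real R"] R order_trans[OF norm_ge_zero] by fastforce
    qed (use R in auto)
    also have "\<dots> = C * pi / R" using R by (simp add: power2_eq_square field_simps)
    finally have "norm (contour_integral (linepath (of_real (-R)) (of_real R)) Q) \<le> C * pi / R" .
    moreover have "contour_integral (linepath (of_real (-R)) (of_real R)) Q = integral {-R..R} (\<lambda>t. Q (of_real t))"
      using R by (subst contour_integral_linepath_Reals_eq) auto
    ultimately show ?thesis by (simp add: R_def)
  qed
  have "(\<lambda>n. integral {- real n..real n} (\<lambda>t. Q (complex_of_real t))) \<longlonglongrightarrow> 0"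
  proof (rule Lim_null_comparison)
    show "\<forall>\<^sub>F n in sequentially. norm (integral {- real n..real n} (\<lambda>t. Q (complex_of_real t))) \<le> C * pi / real n"
      using b eventually_sequentially by blast
    show "(\<lambda>n. C * pi / real n) \<longlonglongrightarrow> 0" by real_asymp
  qed
  then show ?thesis using lborel_integral_eq_limit[OF int] LIMSEQ_unique by blast
qed

text \<open>With decay of order one only, the half circle may contribute.  Division by \<open>1 - \<i> * z / (n + 1)\<close>
  restores quadratic decay, and integrability on the line allows the passage to the limit.\<close>

lemma real_line_integral_eq_0:
  assumes hol: "Q holomorphic_on {z. Im z > -1}"
    and dec: "\<And>z. Im z \<ge> 0 \<Longrightarrow> norm (Q z) \<le> C / (1 + norm z)"
    and int: "integrable lborel (\<lambda>t. Q (complex_of_real t))"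
  shows "(LINT t|lborel. Q (complex_of_real t)) = 0"
proof -
  define d where "d = (\<lambda>n z. 1 - \<i> * of_real (1 / real (Suc n)) * z)"
  have C0: "C \<ge> 0" using order_trans[OF norm_ge_zero dec[of 0]] by simp
  have dn: "norm (d n z) \<ge> 1" "norm (d n z) \<ge> norm z / real (Suc n)" if "Im z \<ge> 0" for n z
  proof -
    define \<delta> where "\<delta> = 1 / real (Suc n)"
    have d: "\<delta> > 0" "d n z = 1 - \<i> * of_real \<delta> * z" by (auto simp: \<delta>_def d_def)
    have "Re (d n z) \<ge> 1" using that d by simp
    then show "norm (d n z) \<ge> 1" using complex_Re_le_cmod order_trans by blast
    have "(norm (d n z))\<^sup>2 = (1 + \<delta> * Im z)\<^sup>2 + (\<delta> * Re z)\<^sup>2"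
      unfolding d by (simp add: cmod_power2)
    also have "\<dots> \<ge> (\<delta> * Im z)\<^sup>2 + (\<delta> * Re z)\<^sup>2"
      using d that by (intro add_right_mono power_mono) auto
    also have "(\<delta> * Im z)\<^sup>2 + (\<delta> * Re z)\<^sup>2 = (\<delta> * norm z)\<^sup>2"
      by (simp add: power_mult_distrib cmod_power2 algebra_simps)
    finally have "\<delta> * norm z \<le> norm (d n z)" by (rule power2_le_imp_le) simp
    then show "norm (d n z) \<ge> norm z / real (Suc n)" by (simp add: \<delta>_def)
  qed
  have mQ: "(\<lambda>t. Q (complex_of_real t)) \<in> borel_measurable lborel" using int by auto
  have md: "(\<lambda>t. Q (complex_of_real t) / d n (complex_of_real t)) \<in> borel_measurable lborel" for n
    unfolding d_def using mQ by measurable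
  have le: "norm (Q (complex_of_real t) / d n (complex_of_real t)) \<le> norm (Q (complex_of_real t))" for n t
    using dn(1)[of "of_real t" n] by (simp add: norm_divide divide_le_eq mult_le_cancel_left1)
  have int': "integrable lborel (\<lambda>t. Q (complex_of_real t) / d n (complex_of_real t))" for n
    using le by (intro Bochner_Integration.integrable_bound[OF integrable_norm[OF int] md]) auto
  have 0: "(LINT t|lborel. Q (complex_of_real t) / d n (complex_of_real t)) = 0" for n
  proof (rule real_line_integral_eq_0_quadratic_decay[OF _ _ int', where C = "C * real (Suc n)"])
    have ne: "d n z \<noteq> 0" if "Im z > -1" for z
    proof -
      have "Im z * (1 / real (Suc n)) > - 1" using that by (simp add: field_simps)
      then have "Re (d n z) > 0" by (simp add: d_def)
      then show ?thesis by auto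
    qed
    then show "(\<lambda>z. Q z / d n z) holomorphic_on {z. Im z > - 1}"
      unfolding d_def by (intro holomorphic_intros hol) auto
    show "norm (Q z / d n z) \<le> C * real (Suc n) / (norm z)\<^sup>2" if z: "Im z \<ge> 0" "norm z \<ge> 1" for z
    proof -
      have "norm (Q z) / norm (d n z) \<le> (C / norm z) / (norm z / real (Suc n))"
      proof (rule frac_le)
        have "C / (1 + norm z) \<le> C / norm z" using C0 z by (intro divide_left_mono) (auto intro!: mult_pos_pos add_pos_nonneg)
        then show "norm (Q z) \<le> C / norm z" using dec[OF z(1)] by linarith
        show "0 < norm z / real (Suc n)" using order_less_le_trans[OF zero_less_one z(2)] by (intro divide_pos_pos) auto
      qed (use C0 z dn(2)[OF z(1)] in auto)
      then show ?thesis by (simp add: norm_divide power2_eq_square field_simps)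
    qed
  qed
  have "(\<lambda>n. LINT t|lborel. Q (complex_of_real t) / d n (complex_of_real t)) \<longlonglongrightarrow> (LINT t|lborel. Q (complex_of_real t))"
  proof (rule integral_dominated_convergence[where w = "\<lambda>t. norm (Q (complex_of_real t))"])
    show "AE t in lborel. (\<lambda>n. Q (complex_of_real t) / d n (complex_of_real t)) \<longlonglongrightarrow> Q (complex_of_real t)"
    proof (rule AE_I2)
      fix t :: real
      have "(\<lambda>n. 1 / real (Suc n)) \<longlonglongrightarrow> 0" by real_asymp
      then have "(\<lambda>n. Q (of_real t) / d n (of_real t)) \<longlonglongrightarrow> Q (of_real t) / (1 - \<i> * of_real 0 * of_real t)"
        unfolding d_def by (intro tendsto_intros) auto
      then show "(\<lambda>n. Q (of_real t) / d n (of_real t)) \<longlonglongrightarrow> Q (of_real t)" by simp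
    qed
  qed (use int mQ md le in auto)
  then show ?thesis unfolding 0 using LIMSEQ_unique tendsto_const by blast
qed

text \<open>If \<open>Im w > -1\<close>, the subtracted term agrees with \<open>F\<close> at \<open>w\<close>, so the quotient has a removable
  singularity there; all other \<open>w\<close> lie away from the half plane of integration.  So neither an
  indentation of the contour for real \<open>w\<close> nor a case distinction by the sign of \<open>Im w\<close> arises.  The
  pole of the subtracted term at \<open>- \<i>\<close> is below the contour, and its factor \<open>1 / (z + \<i>)\<close> makes
  the quotient integrable on the real line.\<close>

lemma hardy_cauchy_integral_eq_0:
  fixes F :: "complex \<Rightarrow> complex" and w :: complex
  assumes hol: "F holomorphic_on UNIV"
    and bd: "\<And>z. Im z \<ge> 0 \<Longrightarrow> norm (F z) \<le> M"
    and L2: "integrable lborel (\<lambda>t. (norm (F (complex_of_real t)))\<^sup>2)"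
  defines "q \<equiv> (\<lambda>z. (F z - F w * (w + \<i>) / (z + \<i>)) / (z - w))"
  shows "integrable lborel (\<lambda>t. q (complex_of_real t))" "(LINT t|lborel. q (complex_of_real t)) = 0"
proof -
  define S where "S = {z. Im z > -1}"
  have opS: "open S" unfolding S_def by (rule open_halfspace_Im_gt)
  define g where "g = (\<lambda>z. F z - F w * (w + \<i>) / (z + \<i>))"
  have ne: "z + \<i> \<noteq> 0" if "z \<in> S" for z using that by (auto simp: S_def complex_eq_iff)
  have holg: "g holomorphic_on S"
    unfolding g_def using ne by (intro holomorphic_intros holomorphic_on_subset[OF hol]) auto
  define Q where "Q = (\<lambda>z. if z = w then deriv g w else q z)"
  have holQ: "Q holomorphic_on S"
  proof (cases "w \<in> S")
    case True
    then have "g w = 0" using ne[OF True] by (simp add: g_def)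
    have "(\<lambda>z. if z = w then deriv g w else q z - g w / (z - w)) holomorphic_on S"
      by (rule pole_theorem_open[OF holg opS]) (simp add: q_def g_def)
    then show ?thesis using \<open>g w = 0\<close> by (simp add: Q_def cong: if_cong)
  next
    case False
    have "(\<lambda>z. g z / (z - w)) holomorphic_on S" using False
      by (intro holomorphic_on_divide holg holomorphic_on_diff holomorphic_on_ident holomorphic_on_const) auto
    then have "q holomorphic_on S" by (simp add: q_def g_def)
    then show ?thesis using False by (subst holomorphic_cong[of S S Q q]) (auto simp: Q_def)
  qed
  have contQ: "continuous_on S Q" by (rule holomorphic_on_imp_continuous_on[OF holQ])
  define R where "R = 2 * norm w + 1"
  have R1: "R \<ge> 1" by (simp add: R_def)
  have cpt: "compact (cball 0 R \<inter> {z. Im z \<ge> 0})"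
    by (intro compact_Int_closed closed_halfspace_Im_ge) auto
  have "bounded (Q ` (cball 0 R \<inter> {z. Im z \<ge> 0}))"
    using cpt by (intro compact_imp_bounded compact_continuous_image continuous_on_subset[OF contQ]) (auto simp: S_def)
  then obtain B where B: "B > 0" "\<And>z. norm z \<le> R \<Longrightarrow> Im z \<ge> 0 \<Longrightarrow> norm (Q z) \<le> B"
    unfolding bounded_pos by auto
  define N where "N = norm (F w * (w + \<i>))"
  have N0: "N \<ge> 0" by (simp add: N_def)
  have M0: "M \<ge> 0" using order_trans[OF norm_ge_zero bd[of 0]] by simp
  have far: "norm (Q z) \<le> (norm (F z) + N / norm (z + \<i>)) * (4 / (1 + norm z))" if z: "Im z \<ge> 0" "norm z > R" for z
  proof -
    have zw: "z \<noteq> w" using z(2) R_def norm_ge_zero[of w] by (auto simp del: norm_ge_zero)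
    have "norm (z - w) \<ge> norm z - norm w" by (rule norm_triangle_ineq2)
    then have 1: "norm (z - w) \<ge> (1 + norm z) / 4" using z(2) unfolding R_def
      using norm_ge_zero[of w] by (simp del: norm_ge_zero)
    have "norm (g z) \<le> norm (F z) + norm (F w * (w + \<i>) / (z + \<i>))"
      unfolding g_def by (rule norm_triangle_ineq4)
    then have "norm (g z) \<le> norm (F z) + N / norm (z + \<i>)" by (simp add: N_def norm_divide)
    then have "norm (g z) / norm (z - w) \<le> (norm (F z) + N / norm (z + \<i>)) / ((1 + norm z) / 4)"
      using 1 N0 by (intro frac_le) (auto intro!: add_nonneg_nonneg add_pos_nonneg)
    then show ?thesis using zw by (simp add: Q_def q_def g_def norm_divide)
  qed
  have zi: "norm (z + \<i>) \<ge> 1" if "Im z \<ge> 0" for z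
    using abs_Im_le_cmod[of "z + \<i>"] that by simp
  have decay: "norm (Q z) \<le> (B * (1 + R) + 4 * (M + N)) / (1 + norm z)" if z: "Im z \<ge> 0" for z
  proof (cases "norm z \<le> R")
    case True
    have "norm (Q z) * (1 + norm z) \<le> B * (1 + R)"
      using B(2)[OF True z] True B(1) by (intro mult_mono) auto
    also have "\<dots> \<le> B * (1 + R) + 4 * (M + N)" using M0 N0 by simp
    finally show ?thesis by (simp add: field_simps add_pos_nonneg)
  next
    case False
    have "N / norm (z + \<i>) \<le> N / 1" using zi[OF z] N0 by (intro divide_left_mono) auto
    then have "norm (F z) + N / norm (z + \<i>) \<le> M + N" using bd[OF z] by simp
    then have "(norm (F z) + N / norm (z + \<i>)) * (4 / (1 + norm z)) \<le> (M + N) * (4 / (1 + norm z))"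
      by (intro mult_right_mono) (auto intro!: divide_nonneg_pos add_pos_nonneg)
    also have "\<dots> \<le> (B * (1 + R) + 4 * (M + N)) / (1 + norm z)"
      using B(1) R1 by (auto simp: field_simps intro!: divide_right_mono)
    finally show ?thesis using far[OF z] False by simp
  qed
  have contQr: "continuous_on UNIV (\<lambda>t. Q (complex_of_real t))"
    by (rule continuous_on_compose2[OF contQ continuous_on_of_real_id]) (auto simp: S_def)
  have mQ: "(\<lambda>t. Q (complex_of_real t)) \<in> borel_measurable lborel"
    using borel_measurable_continuous_onI[OF contQr] by simp
  \<comment> \<open>The last summand covers the bounded range around \<open>w\<close>, the second the subtracted term far out; the
    first comes from splitting the product of \<open>norm (F t)\<close> and \<open>4 / (1 + \<bar>t\<bar>)\<close> by the inequality of means.\<close>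
  define D where "D = 16 + 4 * N + B * (1 + R\<^sup>2)"
  have dom: "norm (Q (complex_of_real t)) \<le> (norm (F (complex_of_real t)))\<^sup>2 + D * inverse (1 + t\<^sup>2)" for t
  proof (cases "\<bar>t\<bar> \<le> R")
    case True
    have p: "1 + t\<^sup>2 > 0" by (simp add: add_pos_nonneg)
    have "t\<^sup>2 \<le> R\<^sup>2" using True R1 abs_le_square_iff[of t R] by simp
    then have "norm (Q (of_real t)) * (1 + t\<^sup>2) \<le> B * (1 + R\<^sup>2)"
      using B(2)[of "of_real t"] True B(1) by (intro mult_mono) auto
    also have "\<dots> \<le> D" using N0 by (simp add: D_def)
    finally have "norm (Q (of_real t)) \<le> D * inverse (1 + t\<^sup>2)" using p by (simp add: field_simps)
    then show ?thesis by (simp add: add_increasing)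
  next
    case False
    define a where "a = norm (F (complex_of_real t))"
    define r where "r = sqrt (1 + t\<^sup>2)"
    have p: "1 + t\<^sup>2 > 0" by (simp add: add_pos_nonneg)
    have r: "r > 0" "r\<^sup>2 = 1 + t\<^sup>2" using p by (auto simp: r_def)
    have nr: "norm (complex_of_real t + \<i>) = r" by (simp add: cmod_def r_def add.commute)
    have "r \<le> 1 + \<bar>t\<bar>" unfolding r_def
      by (rule real_le_lsqrt) (auto simp: power2_eq_square algebra_simps)
    then have le: "4 / (1 + \<bar>t\<bar>) \<le> 4 / r" using r by (intro divide_left_mono) auto
    have "norm (Q (of_real t)) \<le> (a + N / r) * (4 / (1 + \<bar>t\<bar>))"
      using far[of "of_real t"] False by (simp add: a_def nr)
    also have "\<dots> \<le> (a + N / r) * (4 / r)"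
      using le r N0 by (intro mult_left_mono) (auto simp: a_def)
    also have "\<dots> = a * (4 / r) + 4 * N / r\<^sup>2" by (simp add: algebra_simps power2_eq_square add_divide_distrib)
    also have "a * (4 / r) \<le> a\<^sup>2 + 16 / r\<^sup>2"
    proof -
      have "2 * a * (4 / r) \<le> a\<^sup>2 + (4/r)\<^sup>2" by (rule sum_squares_bound)
      moreover have "a * (4 / r) \<ge> 0" using r by (simp add: a_def)
      ultimately show ?thesis by (simp add: power_divide)
    qed
    also have "a\<^sup>2 + 16 / r\<^sup>2 + 4 * N / r\<^sup>2 \<le> a\<^sup>2 + D / r\<^sup>2"
      using B(1) r by (simp add: D_def add_divide_distrib)
    finally show ?thesis by (simp add: a_def r divide_inverse)
  qed
  have intQ: "integrable lborel (\<lambda>t. Q (complex_of_real t))"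
    by (rule Bochner_Integration.integrable_bound[of _ "\<lambda>t. (norm (F (complex_of_real t)))\<^sup>2 + D * inverse (1 + t\<^sup>2)"])
      (use L2 lborel_inverse_1_plus_square(1) mQ order_trans[OF dom abs_ge_self] in auto)
  have Q0: "(LINT t|lborel. Q (complex_of_real t)) = 0"
    by (rule real_line_integral_eq_0[OF holQ[unfolded S_def] decay intQ])
  have ae: "AE t in lborel. Q (complex_of_real t) = q (complex_of_real t)"
    using AE_lborel_singleton[of "Re w"] by eventually_elim (auto simp: Q_def)
  have mq: "(\<lambda>t. q (complex_of_real t)) \<in> borel_measurable lborel"
  proof -
    have "continuous_on UNIV (\<lambda>t. F (complex_of_real t))"
      by (rule continuous_on_compose2[OF holomorphic_on_imp_continuous_on[OF hol] continuous_on_of_real_id]) auto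
    then have "(\<lambda>t. F (complex_of_real t)) \<in> borel_measurable lborel"
      using borel_measurable_continuous_onI by auto
    then show ?thesis unfolding q_def by measurable
  qed
  show "integrable lborel (\<lambda>t. q (complex_of_real t))"
    using integrable_cong_AE[OF mQ mq ae] intQ by simp
  show "(LINT t|lborel. q (complex_of_real t)) = 0"
    using integral_cong_AE[OF mQ mq ae] Q0 by simp
qed

text \<open>Write the sine in the kernel as a difference of two exponentials.  The product of \<open>f\<close> with one of
  them is bounded in the upper half plane, with the other in the lower half plane, which the
  substitution \<open>t \<mapsto> - t\<close> turns into the upper one.  So \<open>hardy_cauchy_integral_eq_0\<close> applies to both.
  The two subtracted terms have poles at \<open>- \<i>\<close> and \<open>\<i>\<close> and combine to a multiple of
  \<open>f w / (1 + t\<^sup>2)\<close>, whose integral is elementary.\<close>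

lemma pw_reproducing:
  assumes s: "\<sigma> > 0" and f: "f \<in> paley_wiener \<sigma>"
  shows "(LINT t|lborel. f (complex_of_real t) * cnj (pw_kernel \<sigma> w (complex_of_real t))) = f w"
proof -
  define K where "K = pw_norm f * exp \<sigma>"
  have fb: "norm (f z) \<le> K * exp (\<sigma> * \<bar>Im z\<bar>)" for z
    using pw_point_bound[OF s f, of z] by (simp add: K_def algebra_simps exp_add)
  note fD = paley_wienerD[OF f]
  define A where "A = (\<lambda>t. (f (complex_of_real t) * exp (\<i> * of_real \<sigma> * (of_real t - w))
      - f w * (w + \<i>) / (of_real t + \<i>)) / (of_real t - w))"
  define B where "B = (\<lambda>t. (f (complex_of_real t) * exp (- \<i> * of_real \<sigma> * (of_real t - w))
      - f w * (w - \<i>) / (of_real t - \<i>)) / (w - of_real t))"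
  have A: "integrable lborel A" "(LINT t|lborel. A t) = 0"
  proof -
    define F where "F = (\<lambda>z. f z * exp (\<i> * of_real \<sigma> * (z - w)))"
    have nF: "norm (F z) = norm (f z) * exp (\<sigma> * Im w - \<sigma> * Im z)" for z
      by (simp add: F_def norm_mult algebra_simps)
    have 1: "F holomorphic_on UNIV" unfolding F_def using fD(1) by (intro holomorphic_intros)
    have 2: "norm (F z) \<le> K * exp (\<sigma> * Im w)" if "Im z \<ge> 0" for z
    proof -
      have "norm (F z) \<le> (K * exp (\<sigma> * Im z)) * exp (\<sigma> * Im w - \<sigma> * Im z)"
        unfolding nF using fb[of z] that by (intro mult_right_mono) auto
      then show ?thesis by (simp add: exp_diff)
    qed
    have 3: "integrable lborel (\<lambda>t. (norm (F (complex_of_real t)))\<^sup>2)"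
      unfolding nF using fD(3) by (simp add: power_mult_distrib)
    have "A = (\<lambda>t. (F (of_real t) - F w * (w + \<i>) / (of_real t + \<i>)) / (of_real t - w))"
      by (auto simp: A_def F_def)
    then show "integrable lborel A" "(LINT t|lborel. A t) = 0"
      using hardy_cauchy_integral_eq_0[OF 1 2 3, of w] by auto
  qed
  have B: "integrable lborel B" "(LINT t|lborel. B t) = 0"
  proof -
    define F where "F = (\<lambda>z. f (- z) * exp (\<i> * of_real \<sigma> * (z + w)))"
    have nF: "norm (F z) = norm (f (- z)) * exp (- \<sigma> * Im w - \<sigma> * Im z)" for z
      by (simp add: F_def norm_mult algebra_simps)
    have "(\<lambda>z. f (- z)) holomorphic_on UNIV"
      using holomorphic_on_compose_gen[OF holomorphic_on_minus[OF holomorphic_on_ident] fD(1)] by (simp add: o_def)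
    then have 1: "F holomorphic_on UNIV" unfolding F_def by (intro holomorphic_intros)
    have 2: "norm (F z) \<le> K * exp (- \<sigma> * Im w)" if "Im z \<ge> 0" for z
    proof -
      have "norm (F z) \<le> (K * exp (\<sigma> * Im z)) * exp (- \<sigma> * Im w - \<sigma> * Im z)"
        unfolding nF using fb[of "-z"] that by (intro mult_right_mono) auto
      then show ?thesis by (simp add: exp_diff)
    qed
    have "integrable lborel (\<lambda>t. (norm (f (complex_of_real (0 + (-1) * t))))\<^sup>2)"
      using fD(3) by (intro lborel_integrable_real_affine) auto
    then have 3: "integrable lborel (\<lambda>t. (norm (F (complex_of_real t)))\<^sup>2)"
      unfolding nF by (simp add: power_mult_distrib)
    have eq: "(\<lambda>t. B (0 + (-1) * t)) = (\<lambda>t. (F (of_real t) - F (- w) * (- w + \<i>) / (of_real t + \<i>)) / (of_real t - - w))"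
    proof
      fix t :: real
      have "(w - \<i>) / (- of_real t - \<i>) = (- w + \<i>) / (of_real t + \<i>)"
        by (metis (no_types, opaque_lifting) add_uminus_conv_diff minus_add_distrib minus_divide_divide minus_minus)
      then have "f w * (w - \<i>) / (- of_real t - \<i>) = f w * (- w + \<i>) / (of_real t + \<i>)"
        by (metis times_divide_eq_right)
      then show "B (0 + (-1) * t) = (F (of_real t) - F (- w) * (- w + \<i>) / (of_real t + \<i>)) / (of_real t - - w)"
        by (simp add: B_def F_def algebra_simps)
    qed
    have i: "integrable lborel (\<lambda>t. B (0 + (-1) * t))" "(LINT t|lborel. B (0 + (-1) * t)) = 0"
      unfolding eq using hardy_cauchy_integral_eq_0[OF 1 2 3, of "-w"] by auto
    show "integrable lborel B" using i(1) by (subst (asm) lborel_integrable_real_affine_iff) auto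
    show "(LINT t|lborel. B t) = 0"
      using lborel_integral_real_affine[of "-1" B 0] i(2) by simp
  qed
  have ptw: "f (of_real t) * cnj (pw_kernel \<sigma> w (of_real t)) = (A t + B t) / (2 * \<i> * of_real pi) + f w / of_real pi * of_real (inverse (1 + t\<^sup>2))"
    if t: "t \<noteq> Re w" for t
  proof -
    define x where "x = complex_of_real t"
    have xw: "x - w \<noteq> 0" "w - x \<noteq> 0" and xi: "x + \<i> \<noteq> 0" "x - \<i> \<noteq> 0" using t by (auto simp: x_def complex_eq_iff)
    have ker: "cnj (pw_kernel \<sigma> w x) = sin (of_real \<sigma> * (x - w)) / (of_real pi * (x - w))"
    proof -
      have "x \<noteq> cnj w" using t by (auto simp: x_def complex_eq_iff)
      then show ?thesis by (simp add: pw_kernel_def x_def cnj_sin)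
    qed
    have sn: "exp (\<i> * of_real \<sigma> * (x - w)) - exp (- \<i> * of_real \<sigma> * (x - w)) = 2 * \<i> * sin (of_real \<sigma> * (x - w))"
      by (simp add: sin_exp_eq mult.assoc) (simp add: field_simps)
    have fr: "(w + \<i>) / (x + \<i>) - (w - \<i>) / (x - \<i>) = 2 * \<i> * (x - w) / (x\<^sup>2 + 1)"
    proof -
      have "(x + \<i>) * (x - \<i>) = x\<^sup>2 + 1" by (simp add: algebra_simps power2_eq_square)
      then show ?thesis using xi by (simp add: diff_frac_eq) (simp add: algebra_simps power2_eq_square)
    qed
    have "A t + B t = (f x * (exp (\<i> * of_real \<sigma> * (x - w)) - exp (- \<i> * of_real \<sigma> * (x - w)))
        - f w * ((w + \<i>) / (x + \<i>) - (w - \<i>) / (x - \<i>))) / (x - w)"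
    proof -
      have "B t = - ((f x * exp (- \<i> * of_real \<sigma> * (x - w)) - f w * (w - \<i>) / (x - \<i>)) / (x - w))"
        unfolding B_def x_def[symmetric] by (metis minus_diff_eq minus_divide_right)
      then show ?thesis unfolding A_def x_def[symmetric]
        by (simp add: diff_divide_distrib right_diff_distrib)
    qed
    also have "\<dots> = (f x * (2 * \<i> * sin (of_real \<sigma> * (x - w))) - f w * (2 * \<i> * (x - w) / (x\<^sup>2 + 1))) / (x - w)"
      unfolding sn fr ..
    also have "\<dots> = 2 * \<i> * of_real pi * (f x * cnj (pw_kernel \<sigma> w x)) - 2 * \<i> * f w / (x\<^sup>2 + 1)"
    proof -
      have "f w * (2 * \<i> * (x - w) / (x\<^sup>2 + 1)) / (x - w) = 2 * \<i> * f w / (x\<^sup>2 + 1)"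
        using xw by simp
      moreover have "f x * (2 * \<i> * sin (of_real \<sigma> * (x - w))) / (x - w) = 2 * \<i> * of_real pi * (f x * cnj (pw_kernel \<sigma> w x))"
        unfolding ker by (simp add: mult_ac)
      ultimately show ?thesis by (simp only: diff_divide_distrib)
    qed
    finally have e: "A t + B t = 2 * \<i> * of_real pi * (f x * cnj (pw_kernel \<sigma> w x)) - 2 * \<i> * f w / (x\<^sup>2 + 1)" .
    have "of_real (inverse (1 + t\<^sup>2)) = 1 / (x\<^sup>2 + 1)" by (simp add: x_def divide_inverse add.commute)
    then show ?thesis unfolding e x_def[symmetric] by (simp add: diff_divide_distrib)
  qed
  have mk: "(\<lambda>t. f (complex_of_real t) * cnj (pw_kernel \<sigma> w (complex_of_real t))) \<in> borel_measurable lborel"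
    using borel_measurable_continuous_onI[OF continuous_on_mult[OF fD(4) continuous_on_cnj[OF paley_wienerD(4)[OF pw_kernel_mem[OF s]]]]]
    by simp
  have mr: "(\<lambda>t. (A t + B t) / (2 * \<i> * of_real pi) + f w / of_real pi * complex_of_real (inverse (1 + t\<^sup>2))) \<in> borel_measurable lborel"
    using A(1) B(1) by measurable
  have ae: "AE t in lborel. f (complex_of_real t) * cnj (pw_kernel \<sigma> w (complex_of_real t)) =
      (A t + B t) / (2 * \<i> * of_real pi) + f w / of_real pi * complex_of_real (inverse (1 + t\<^sup>2))"
    using AE_lborel_singleton[of "Re w"] by eventually_elim (rule ptw)
  have "(LINT t|lborel. f (complex_of_real t) * cnj (pw_kernel \<sigma> w (complex_of_real t))) =
    (LINT t|lborel. (A t + B t) / (2 * \<i> * of_real pi) + f w / of_real pi * complex_of_real (inverse (1 + t\<^sup>2)))"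
    by (rule integral_cong_AE[OF mk mr ae])
  also have "\<dots> = f w / of_real pi * complex_of_real (LINT t|lborel. inverse (1 + t\<^sup>2))"
    using A B lborel_inverse_1_plus_square(1)
    by (subst Bochner_Integration.integral_add) (auto simp del: of_real_inverse)
  also have "\<dots> = f w" by (simp add: lborel_inverse_1_plus_square(2))
  finally show ?thesis .
qed

section \<open>Zeros in arithmetic progression\<close>

lemma sin_pi_lower_bound_real:
  assumes "0 < r" "r \<le> 1/2" and "\<And>n::int. \<bar>x - of_int n\<bar> \<ge> r"
  shows "\<bar>sin (pi * x)\<bar> \<ge> sin (pi * r)"
proof -
  define u where "u = x - of_int (round x)"
  have u: "\<bar>u\<bar> \<le> 1/2" "\<bar>u\<bar> \<ge> r"
    using of_int_round_abs_le[of x] assms(3)[of "round x"] by (auto simp: u_def abs_minus_commute)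
  have "pi * x = pi * u + pi * of_int (round x)" by (simp add: u_def algebra_simps)
  then have "\<bar>sin (pi * x)\<bar> = \<bar>sin (pi * u)\<bar>"
    by (simp add: sin_add abs_mult cos_npi_int)
  also have "\<bar>sin (pi * u)\<bar> = \<bar>sin (pi * \<bar>u\<bar>)\<bar>" by (cases "u \<ge> 0") auto
  also have "\<dots> \<ge> sin (pi * \<bar>u\<bar>)" by simp
  also have "sin (pi * r) \<le> sin (pi * \<bar>u\<bar>)"
  proof (rule sin_monotone_2pi_le)
    have "pi * \<bar>u\<bar> \<le> pi * (1/2)" using u by (intro mult_left_mono) auto
    then show "pi * \<bar>u\<bar> \<le> pi / 2" by simp
    have "0 \<le> pi * r" using assms by simp
    then show "- (pi / 2) \<le> pi * r" using pi_ge_zero by linarith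
    show "pi * r \<le> pi * \<bar>u\<bar>" using u by simp
  qed
  finally show ?thesis by simp
qed

text \<open>Away from the integers, \<open>sin (pi * z)\<close> is as large as its exponential growth permits.  Far from the real
  axis this comes from the hyperbolic part; near it the real part is away from the integers.\<close>

lemma sin_pi_lower_bound:
  assumes r: "0 < r" "r \<le> 1/2"
  obtains \<kappa> where "\<kappa> > 0"
    "\<And>z. (\<And>n::int. norm (z - of_int n) \<ge> r) \<Longrightarrow> norm (sin (of_real pi * z)) \<ge> \<kappa> * exp (pi * \<bar>Im z\<bar>)"
proof -
  define s where "s = sin (pi * (r/2))"
  have s: "s > 0" unfolding s_def
  proof (rule sin_gt_zero)
    have "pi * (r / 2) < pi * 1" using r by (intro mult_strict_left_mono) auto
    then show "pi * (r / 2) < pi" by simp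
  qed (use r in auto)
  define q where "q = (1 - exp (- (pi * r))) / 2"
  have q: "q > 0" using r by (simp add: q_def)
  define \<kappa> where "\<kappa> = min q (s * exp (- (pi * r / 2)))"
  have "norm (sin (of_real pi * z)) \<ge> \<kappa> * exp (pi * \<bar>Im z\<bar>)" if z: "\<And>n::int. norm (z - of_int n) \<ge> r" for z
  proof -
    define y where "y = pi * \<bar>Im z\<bar>"
    define E where "E = exp (2 * y)"
    have E: "E \<ge> 1" unfolding E_def y_def by simp
    have "(norm (sin (of_real pi * z)))\<^sup>2 = (exp (2 * (pi * Im z)) + inverse (exp (2 * (pi * Im z))) - 2 * cos (2 * (pi * Re z))) / 4"
      by (subst norm_sin_squared) simp
    also have "exp (2 * (pi * Im z)) + inverse (exp (2 * (pi * Im z))) = E + inverse E"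
      by (cases "Im z \<ge> 0") (auto simp: E_def y_def exp_minus)
    also have "cos (2 * (pi * Re z)) = 1 - 2 * (sin (pi * Re z))\<^sup>2" by (rule cos_double_sin)
    finally have nsq: "(norm (sin (of_real pi * z)))\<^sup>2 = (E + inverse E - 2) / 4 + (sin (pi * Re z))\<^sup>2"
      by (simp add: field_simps)
    have eE: "(exp y)\<^sup>2 = E" by (simp add: E_def exp_double)
    show ?thesis
    proof (cases "\<bar>Im z\<bar> \<ge> r / 2")
      case True
      have "pi * r \<le> 2 * y" using True by (simp add: y_def)
      then have "inverse E \<le> exp (- (pi * r))" by (simp add: E_def flip: exp_minus)
      then have "2 * q \<le> 1 - inverse E" by (simp add: q_def)
      then have "(2 * q)\<^sup>2 \<le> (1 - inverse E)\<^sup>2" using q by (intro power_mono) auto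
      then have "E * (2 * q)\<^sup>2 / 4 \<le> E * (1 - inverse E)\<^sup>2 / 4" using E by simp
      also have "E * (1 - inverse E)\<^sup>2 / 4 = (E + inverse E - 2) / 4"
        using E by (simp add: power2_eq_square field_simps)
      also have "\<dots> \<le> (norm (sin (of_real pi * z)))\<^sup>2" unfolding nsq by simp
      finally have "(q * exp y)\<^sup>2 \<le> (norm (sin (of_real pi * z)))\<^sup>2"
        by (simp add: power_mult_distrib eE mult.commute)
      then have "q * exp y \<le> norm (sin (of_real pi * z))" by (rule power2_le_imp_le) simp
      moreover have "\<kappa> * exp y \<le> q * exp y" by (intro mult_right_mono) (auto simp: \<kappa>_def)
      ultimately have "\<kappa> * exp y \<le> norm (sin (of_real pi * z))" by linarith
      then show ?thesis by (simp add: y_def)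
    next
      case False
      have re: "\<bar>Re z - of_int n\<bar> \<ge> r / 2" for n :: int
        using z[of n] cmod_le[of "z - of_int n"] False by simp
      have "s \<le> \<bar>sin (pi * Re z)\<bar>"
        unfolding s_def by (rule sin_pi_lower_bound_real) (use r re in auto)
      then have "s\<^sup>2 \<le> (sin (pi * Re z))\<^sup>2" using s abs_le_square_iff[of s "sin (pi * Re z)"] by simp
      also have "\<dots> \<le> (norm (sin (of_real pi * z)))\<^sup>2"
      proof -
        have "E + inverse E - 2 = (E - 1)\<^sup>2 / E" using E by (simp add: power2_eq_square field_simps)
        also have "\<dots> \<ge> 0" using E by simp
        finally show ?thesis unfolding nsq by simp
      qed
      finally have 1: "s \<le> norm (sin (of_real pi * z))" by (rule power2_le_imp_le) simp
      have "exp (- (pi * r / 2)) * exp y \<le> 1" using False by (simp add: y_def flip: exp_add)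
      then have "s * (exp (- (pi * r / 2)) * exp y) \<le> s * 1" using s by (intro mult_left_mono) auto
      moreover have "\<kappa> * exp y \<le> (s * exp (- (pi * r / 2))) * exp y" by (intro mult_right_mono) (auto simp: \<kappa>_def)
      ultimately have "\<kappa> * exp y \<le> norm (sin (of_real pi * z))" using 1 by (simp only: mult.assoc)
      then show ?thesis by (simp add: y_def)
    qed
  qed
  moreover have "\<kappa> > 0" using q s by (simp add: \<kappa>_def)
  ultimately show ?thesis using that by blast
qed

text \<open>The quotient with its removable singularities at the common zeros filled in by the rule of de l'Hospital.\<close>

definition quotient_by_sin :: "(complex \<Rightarrow> complex) \<Rightarrow> complex \<Rightarrow> complex" where
  "quotient_by_sin F z =
     (if z \<in> \<int> then deriv F z / (of_real pi * cos (of_real pi * z)) else F z / sin (of_real pi * z))"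

lemma sin_pi_eq_0_iff: "sin (of_real pi * z :: complex) = 0 \<longleftrightarrow> z \<in> \<int>"
proof -
  have "sin (of_real pi * z) = 0 \<longleftrightarrow> (\<exists>n::int. of_real pi * z = of_real (of_int n * pi))"
    by (simp add: Complex_Transcendental.sin_eq_0)
  also have "\<dots> \<longleftrightarrow> (\<exists>n::int. z = of_int n)" by (auto simp: mult.commute)
  finally show ?thesis by (auto simp: Ints_def)
qed

lemma quotient_by_sin_holomorphic:
  assumes hol: "F holomorphic_on UNIV" and "open \<Omega>" and zero: "\<And>z. z \<in> \<Omega> \<Longrightarrow> z \<in> \<int> \<Longrightarrow> F z = 0"
  shows "quotient_by_sin F holomorphic_on \<Omega>"
proof -
  have "quotient_by_sin F field_differentiable at z" if z: "z \<in> \<Omega>" for z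
  proof (cases "z \<in> \<int>")
    case False
    define V where "V = - (\<int> :: complex set)"
    have opV: "open V" unfolding V_def by (simp add: closed_Ints open_Compl)
    have "(\<lambda>z. F z / sin (of_real pi * z)) holomorphic_on V"
      by (intro holomorphic_intros holomorphic_on_subset[OF hol]) (auto simp: V_def sin_pi_eq_0_iff)
    then have "quotient_by_sin F holomorphic_on V"
      by (rule holomorphic_transform) (auto simp: V_def quotient_by_sin_def)
    then show ?thesis using False opV by (auto simp: holomorphic_on_open V_def field_differentiable_def)
  next
    case True
    then obtain n where n: "z = of_int n" by (auto elim: Ints_cases)
    define V where "V = ball z 1"
    have opV: "open V" "z \<in> V" by (auto simp: V_def)
    have Vint: "v \<notin> \<int>" if "v \<in> V" "v \<noteq> z" for v
    proof
      assume "v \<in> \<int>"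
      then obtain m where m: "v = of_int m" by (auto elim: Ints_cases)
      have "norm (z - v) = of_int \<bar>n - m\<bar>" unfolding n m by (metis norm_of_int of_int_diff of_int_abs)
      moreover have "norm (z - v) < 1" using that by (simp add: V_def dist_norm)
      ultimately show False using that n m by simp
    qed
    define f1 where "f1 = (\<lambda>v. if v = z then deriv F z else F v / (v - z))"
    define f2 where "f2 = (\<lambda>v. if v = z then of_real pi * cos (of_real pi * z) else sin (of_real pi * v) / (v - z))"
    have "f1 holomorphic_on V"
      by (rule pole_theorem_open_0[OF holomorphic_on_subset[OF hol] opV(1), where a = z])
         (use zero[OF z True] in \<open>auto simp: f1_def\<close>)
    moreover have "f2 holomorphic_on V"
    proof (rule pole_theorem_open_0[OF _ opV(1), where a = z])
      show "(\<lambda>v. sin (of_real pi * v)) holomorphic_on V" by (intro holomorphic_intros)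
      have "((\<lambda>v. sin (of_real pi * v)) has_field_derivative of_real pi * cos (of_real pi * z)) (at z)"
        by (auto intro!: derivative_eq_intros)
      then show "f2 z = deriv (\<lambda>v. sin (of_real pi * v)) z" by (simp add: f2_def DERIV_imp_deriv)
      show "sin (of_real pi * z) = 0" using True by (simp add: sin_pi_eq_0_iff)
    qed (auto simp: f2_def)
    moreover have "f2 v \<noteq> 0" if "v \<in> V" for v
    proof (cases "v = z")
      case True
      have "sin (of_real pi * z) = 0" using \<open>z \<in> \<int>\<close> by (simp add: sin_pi_eq_0_iff)
      then have "cos (of_real pi * z) \<noteq> 0" using sin_cos_squared_add[of "of_real pi * z"] by auto
      then show ?thesis using True by (simp add: f2_def)
    next
      case False
      then show ?thesis using Vint[OF that] by (simp add: f2_def sin_pi_eq_0_iff)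
    qed
    ultimately have "(\<lambda>v. f1 v / f2 v) holomorphic_on V" by (intro holomorphic_intros)
    then have "quotient_by_sin F holomorphic_on V"
    proof (rule holomorphic_transform)
      show "f1 v / f2 v = quotient_by_sin F v" if "v \<in> V" for v
        using Vint[OF that] True by (cases "v = z") (auto simp: f1_def f2_def quotient_by_sin_def)
    qed
    then show ?thesis using opV by (auto simp: holomorphic_on_open field_differentiable_def)
  qed
  then show ?thesis by (simp add: holomorphic_on_def field_differentiable_at_within)
qed

text \<open>The half plane is \<open>Re (cnj \<omega> * z) \<ge> 0\<close>, tilted by the argument of \<open>\<omega>\<close>; it contains the positive
  axis in its interior because \<open>Re \<omega> > 0\<close>.  The bound on \<open>F\<close> is assumed on a slightly larger half
  plane, so that small discs around integers close to the boundary still fit in; such integers are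
  nonnegative, and there \<open>F\<close> vanishes.  With \<open>c = pi - a\<close>, the quotient \<open>G\<close> of \<open>F\<close> by
  \<open>sin (pi * z)\<close> is bounded by a multiple of \<open>exp (- c * \<bar>Im z\<bar>)\<close>, near the integers by the maximum
  principle.  Along directions close to the boundary of the half plane this decay outweighs
  \<open>exp (\<mu> * z / \<omega>)\<close> for any given \<open>\<mu>\<close>; by the sector principle
  \<open>G (\<omega> * x) = O(exp (- \<mu> * x))\<close> with a constant independent of \<open>\<mu>\<close>, hence \<open>G\<close> vanishes on the ray
  through \<open>\<omega>\<close>.\<close>

lemma carlson_half_plane:
  fixes F :: "complex \<Rightarrow> complex" and \<omega> :: complex
  assumes hol: "F holomorphic_on UNIV" and \<omega>: "norm \<omega> = 1" "Re \<omega> > 0" and a: "a < pi"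
    and bd: "\<And>z. Re (cnj \<omega> * z) \<ge> - Re \<omega> \<Longrightarrow> norm (F z) \<le> C * exp (a * \<bar>Im z\<bar>)"
    and zero: "\<And>n::nat. F (of_nat n) = 0"
  shows "F z = 0"
proof -
  define p where "p = Re \<omega>"
  define q where "q = Im \<omega>"
  have p: "p > 0" "p \<le> 1" using \<omega> complex_Re_le_cmod[of \<omega>] by (auto simp: p_def)
  define r where "r = p / 4"
  have r: "r > 0" "r \<le> 1/4" using p by (auto simp: r_def)
  define c where "c = pi - a"
  have c: "c > 0" using a by (simp add: c_def)
  have C0: "C \<ge> 0" using order_trans[OF norm_ge_zero bd[of 0]] p by (simp add: p_def)
  define \<Omega> where "\<Omega> = {z. Re (cnj \<omega> * z) > - p}"
  have op\<Omega>: "open \<Omega>" unfolding \<Omega>_def by (intro open_Collect_less continuous_intros)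
  have int\<Omega>: "\<exists>m::nat. z = of_nat m" if z: "z \<in> \<Omega>" "z \<in> \<int>" for z
  proof -
    obtain n where n: "z = of_int n" using z(2) by (auto elim: Ints_cases)
    have "p * of_int n > - p" using z(1) n by (simp add: \<Omega>_def p_def)
    then have "p * (of_int n + 1) > 0" by (simp add: algebra_simps)
    then have "of_int n + 1 > (0::real)" using p by (simp add: zero_less_mult_iff)
    then have "n \<ge> 0" by linarith
    then show ?thesis using n by (metis nat_0_le of_int_of_nat_eq)
  qed
  define G where "G = quotient_by_sin F"
  have holG: "G holomorphic_on \<Omega>"
    unfolding G_def using int\<Omega> zero by (intro quotient_by_sin_holomorphic hol op\<Omega>) auto
  obtain \<kappa> where \<kappa>: "\<kappa> > 0"
    "\<And>z. (\<And>n::int. norm (z - of_int n) \<ge> r) \<Longrightarrow> norm (sin (of_real pi * z)) \<ge> \<kappa> * exp (pi * \<bar>Im z\<bar>)"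
  proof -
    have "r \<le> 1/2" using r by linarith
    from sin_pi_lower_bound[OF r(1) this] show ?thesis using that by blast
  qed
  have far: "norm (G z) \<le> C / \<kappa> * exp (- c * \<bar>Im z\<bar>)"
    if z: "z \<in> \<Omega>" "\<And>n::int. norm (z - of_int n) \<ge> r" for z
  proof -
    have nz: "z \<notin> \<int>"
    proof
      assume "z \<in> \<int>"
      then obtain n where "z = of_int n" by (auto elim: Ints_cases)
      then show False using z(2)[of n] r by simp
    qed
    have "norm (F z) \<le> C * exp (a * \<bar>Im z\<bar>)" using bd[of z] z(1) by (simp add: \<Omega>_def p_def)
    then have "norm (F z) / norm (sin (of_real pi * z)) \<le> (C * exp (a * \<bar>Im z\<bar>)) / (\<kappa> * exp (pi * \<bar>Im z\<bar>))"
      using \<kappa>(2)[OF z(2)] \<kappa>(1) C0 by (intro frac_le) auto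
    also have "\<dots> = C / \<kappa> * exp (- c * \<bar>Im z\<bar>)"
      by (simp add: c_def exp_diff algebra_simps)
    finally show ?thesis using nz by (simp add: G_def quotient_by_sin_def norm_divide)
  qed
  define C1 where "C1 = C / \<kappa> * exp (c * r)"
  have C1: "C1 \<ge> C / \<kappa>" "C1 \<ge> 0"
    using C0 \<kappa>(1) c r mult_left_mono[of 1 "exp (c * r)" "C / \<kappa>"] by (auto simp: C1_def)
  have Gb: "norm (G z) \<le> C1 * exp (- c * \<bar>Im z\<bar>)" if z: "Re (cnj \<omega> * z) \<ge> 0" for z
  proof (cases "\<forall>n::int. norm (z - of_int n) \<ge> r")
    case True
    have "z \<in> \<Omega>" using z p by (simp add: \<Omega>_def)
    then have "norm (G z) \<le> C / \<kappa> * exp (- c * \<bar>Im z\<bar>)" using far True by blast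
    also have "\<dots> \<le> C1 * exp (- c * \<bar>Im z\<bar>)" using C1 by (intro mult_right_mono) auto
    finally show ?thesis .
  next
    case False
    then obtain n :: int where n: "norm (z - of_int n) < r" by (auto simp: not_le)
    have sub: "cball (of_int n) r \<subseteq> \<Omega>"
    proof
      fix v assume "v \<in> cball (of_int n :: complex) r"
      then have "norm (v - of_int n) \<le> r" by (simp add: dist_norm norm_minus_commute)
      then have "norm (z - v) \<le> 2 * r" using n norm_triangle_ineq4[of "z - of_int n" "v - of_int n"] by simp
      then have "norm (cnj \<omega> * (z - v)) \<le> 2 * r" using \<omega> by (simp add: norm_mult)
      then have "Re (cnj \<omega> * (z - v)) \<le> 2 * r" using complex_Re_le_cmod order_trans by blast
      then have "Re (cnj \<omega> * v) \<ge> - (2 * r)" using z by (simp add: algebra_simps)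
      then show "v \<in> \<Omega>" using p by (simp add: \<Omega>_def r_def)
    qed
    have "norm (G z) \<le> C / \<kappa>"
    proof (rule maximum_modulus_frontier[of G "cball (of_int n) r"])
      show "G holomorphic_on interior (cball (of_int n) r)"
        using holG sub interior_subset holomorphic_on_subset by blast
      show "continuous_on (closure (cball (of_int n) r)) G"
        using holomorphic_on_imp_continuous_on[OF holG] sub continuous_on_subset by (metis closure_closed closed_cball)
      show "z \<in> cball (of_int n) r" using n by (simp add: dist_norm norm_minus_commute)
      fix v assume "v \<in> frontier (cball (of_int n :: complex) r)"
      then have v: "norm (v - of_int n) = r" using r by (simp add: dist_norm norm_minus_commute)
      have "norm (v - of_int m) \<ge> r" for m :: int
      proof (cases "m = n")
        case False
        then have "1 \<le> \<bar>n - m\<bar>" by simp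
        then have "1 \<le> norm (of_int n - of_int m :: complex)"
          by (metis norm_of_int of_int_diff of_int_abs of_int_1_le_iff)
        also have "\<dots> \<le> norm (v - of_int m) + norm (v - of_int n)"
          using norm_triangle_ineq4[of "v - of_int m" "v - of_int n"] by simp
        finally show ?thesis using v r by simp
      qed (use v in simp)
      moreover have "v \<in> \<Omega>" using v sub by (auto simp: dist_norm norm_minus_commute)
      ultimately have "norm (G v) \<le> C / \<kappa> * exp (- c * \<bar>Im v\<bar>)" using far by blast
      also have "\<dots> \<le> C / \<kappa> * 1" using C0 \<kappa>(1) c by (intro mult_left_mono) auto
      finally show "norm (G v) \<le> C / \<kappa>" by simp
    qed auto
    also have "\<dots> \<le> C / \<kappa> * (exp (c * r) * exp (- c * \<bar>Im z\<bar>))"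
    proof -
      have "\<bar>Im z\<bar> \<le> r" using n abs_Im_le_cmod[of "z - of_int n"] by simp
      then have "c * \<bar>Im z\<bar> \<le> c * r" using c by simp
      then have "1 \<le> exp (c * r) * exp (- c * \<bar>Im z\<bar>)" by (simp flip: exp_add)
      from mult_left_mono[OF this, of "C / \<kappa>"] C0 \<kappa>(1) show ?thesis by simp
    qed
    finally show ?thesis by (simp add: C1_def mult.assoc)
  qed
  have ray: "G (\<omega> * of_real x) = 0" if x: "x > 0" for x
  proof (rule ccontr)
    assume "G (\<omega> * of_real x) \<noteq> 0"
    define g where "g = norm (G (\<omega> * of_real x))"
    have g: "g > 0" using \<open>G (\<omega> * of_real x) \<noteq> 0\<close> by (simp add: g_def)
    \<comment> \<open>Large enough for \<open>g * exp (\<mu> * x)\<close> to exceed the bound \<open>C1\<close> found below.\<close>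
    define \<mu> where "\<mu> = (C1 / g + 1) / x"
    have \<mu>: "\<mu> > 0" using g C1 x by (simp add: \<mu>_def add_nonneg_pos)
    \<comment> \<open>At this slope the decay of \<open>G\<close> outweighs \<open>exp (\<mu> * z)\<close> on the boundary rays.\<close>
    define k where "k = (\<mu> / c + \<bar>q\<bar>) / p"
    have k: "k > 0" using \<mu> c p by (simp add: k_def add_pos_nonneg)
    have cw: "cnj \<omega> * (\<omega> * z) = z" for z
      using \<omega> by (metis complex_norm_square mult.assoc mult.commute mult_1 of_real_1 one_power2)
    have "norm (G (\<omega> * of_real x) * exp (of_real \<mu> * of_real x)) \<le> C1"
    proof (rule phragmen_lindelof_sector[where H = "\<lambda>z. G (\<omega> * z) * exp (of_real \<mu> * z)" and U = "{z. Re z > - p}" and k = k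
          and A = C1 and B = \<mu>])
      have Re0: "Re z \<ge> 0" if "\<bar>Im z\<bar> \<le> k * Re z" for z
        using order_trans[OF abs_ge_zero that] k by (simp add: zero_le_mult_iff)
      have nH: "norm (G (\<omega> * z) * exp (of_real \<mu> * z)) \<le> C1 * exp (- c * \<bar>Im (\<omega> * z)\<bar>) * exp (\<mu> * Re z)"
        if "\<bar>Im z\<bar> \<le> k * Re z" for z
        using Gb[of "\<omega> * z"] Re0[OF that] unfolding cw by (simp add: norm_mult mult_right_mono)
      show "{z. \<bar>Im z\<bar> \<le> k * Re z} \<subseteq> {z. Re z > - p}" using Re0 p by force
      have "(\<lambda>z. G (\<omega> * z)) holomorphic_on {z. Re z > - p}"
        using holomorphic_on_compose_gen[OF holomorphic_on_mult[OF holomorphic_on_const holomorphic_on_ident] holG, of \<omega> "{z. Re z > - p}"]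
        by (simp add: o_def \<Omega>_def image_subset_iff cw del: times_complex.sel complex_cnj)
      then show "(\<lambda>z. G (\<omega> * z) * exp (of_real \<mu> * z)) holomorphic_on {z. Re z > - p}"
        by (intro holomorphic_intros)
      show "norm (G (\<omega> * z) * exp (of_real \<mu> * z)) \<le> C1 * exp (\<mu> * norm z)" if "\<bar>Im z\<bar> \<le> k * Re z" for z
      proof -
        have "C1 * exp (- c * \<bar>Im (\<omega> * z)\<bar>) * exp (\<mu> * Re z) \<le> C1 * 1 * exp (\<mu> * norm z)"
          using C1 c \<mu> complex_Re_le_cmod[of z] by (intro mult_mono mult_left_mono) auto
        then show ?thesis using nH[OF that] by simp
      qed
      show "norm (G (\<omega> * z) * exp (of_real \<mu> * z)) \<le> C1" if z: "\<bar>Im z\<bar> = k * Re z" for z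
      proof -
        have R0: "Re z \<ge> 0" using Re0 z by simp
        have "\<bar>Im (\<omega> * z)\<bar> = \<bar>p * Im z + q * Re z\<bar>" by (simp add: p_def q_def)
        also have "\<dots> \<ge> \<bar>p * Im z\<bar> - \<bar>q * Re z\<bar>" by linarith
        also have "\<bar>p * Im z\<bar> - \<bar>q * Re z\<bar> = (p * k - \<bar>q\<bar>) * Re z"
          using z R0 p by (simp add: abs_mult algebra_simps)
        also have "p * k - \<bar>q\<bar> = \<mu> / c" using p by (simp add: k_def)
        finally have "c * \<bar>Im (\<omega> * z)\<bar> \<ge> \<mu> * Re z" using c by (simp add: field_simps)
        then have "exp (- c * \<bar>Im (\<omega> * z)\<bar>) * exp (\<mu> * Re z) \<le> 1" by (simp flip: exp_add)
        from mult_left_mono[OF this C1(2)] show ?thesis using nH[of z] z by (simp add: mult.assoc)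
      qed
      show "\<bar>Im (of_real x)\<bar> \<le> k * Re (of_real x)" using k x by simp
    qed (use k in auto)
    then have "g * exp (\<mu> * x) \<le> C1" by (simp add: norm_mult g_def)
    moreover have "exp (\<mu> * x) \<ge> 1 + (C1 / g + 1)" using exp_ge_add_one_self[of "\<mu> * x"] x by (simp add: \<mu>_def)
    then have "g * exp (\<mu> * x) \<ge> g * (1 + (C1 / g + 1))" using g by (intro mult_left_mono) auto
    moreover have "g * (1 + (C1 / g + 1)) = 2 * g + C1" using g by (simp add: field_simps)
    ultimately show False using g by linarith
  qed
  have Fray: "F (\<omega> * of_real x) = 0" if x: "x > 0" for x
  proof (cases "\<omega> * of_real x \<in> \<int>")
    case True
    have "cnj \<omega> * (\<omega> * of_real x) = of_real x"
      using \<omega> by (metis complex_norm_square mult.assoc mult.commute mult_1 of_real_1 one_power2)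
    then have "Re (cnj \<omega> * (\<omega> * of_real x)) = x" by (metis Re_complex_of_real)
    then have "\<omega> * of_real x \<in> \<Omega>" using x p unfolding \<Omega>_def by (simp only: mem_Collect_eq)
    then show ?thesis using int\<Omega> True zero by force
  next
    case False
    then show ?thesis using ray[OF x] by (simp add: G_def quotient_by_sin_def sin_pi_eq_0_iff)
  qed
  have lim: "\<omega> islimpt (\<lambda>x. \<omega> * of_real x) ` {0<..}"
    unfolding islimpt_approachable
  proof (intro allI impI)
    fix e :: real assume e: "e > 0"
    have dist: "dist (\<omega> * of_real (1 + e / 2)) \<omega> = e / 2"
    proof -
      have "\<omega> * of_real (1 + e / 2) - \<omega> = \<omega> * of_real (e / 2)" by (simp add: algebra_simps)
      then show ?thesis using \<omega> e by (simp only: dist_norm norm_mult norm_of_real)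
    qed
    have ne: "\<omega> * of_real (1 + e / 2) \<noteq> \<omega>"
    proof
      assume "\<omega> * of_real (1 + e / 2) = \<omega>"
      then show False using dist e by (simp only: dist_self)
    qed
    have dlt: "dist (\<omega> * of_real (1 + e / 2)) \<omega> < e" unfolding dist using e by simp
    have mem: "\<omega> * of_real (1 + e / 2) \<in> (\<lambda>x. \<omega> * of_real x) ` {0<..}"
      using e by (intro imageI) (simp add: add_pos_nonneg)
    show "\<exists>x'\<in>(\<lambda>x. \<omega> * of_real x) ` {0<..}. x' \<noteq> \<omega> \<and> dist x' \<omega> < e"
      using ne dlt mem by blast
  qed
  show ?thesis
    by (rule analytic_continuation[OF hol open_UNIV connected_UNIV _ _ lim]) (use Fray in auto)
qed

text \<open>For real \<open>b\<close> the half plane is \<open>Re \<zeta> \<ge> 0\<close> and \<open>a = \<sigma> * \<bar>b\<bar> < pi\<close>.  For other \<open>b\<close> the zeros run into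
  the upper or the lower half plane of the variable \<open>z\<close>, where \<open>u\<close> times one of the exponentials
  \<open>exp (\<plusminus> \<i> * \<sigma> * z)\<close> is bounded; the corresponding half plane of \<open>\<zeta>\<close> is tilted and \<open>a = 0\<close>.\<close>

lemma entire_eq_0_of_progression:
  fixes u :: "complex \<Rightarrow> complex"
  assumes hol: "u holomorphic_on UNIV" and s: "\<sigma> > 0"
    and bd: "\<And>z. norm (u z) \<le> C * exp (\<sigma> * \<bar>Im z\<bar>)"
    and b: "b \<notin> \<real> \<or> (b \<in> \<real> \<and> 0 < norm b \<and> norm b < pi / \<sigma>)"
    and zero: "\<And>n::nat. u (w - of_nat n * cnj b) = 0"
  shows "u z = 0"
proof -
  define \<beta> where "\<beta> = cnj b"
  have \<beta>0: "\<beta> \<noteq> 0" using b by (auto simp: \<beta>_def)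
  have C0: "C \<ge> 0" using order_trans[OF norm_ge_zero bd[of 0]] by simp
  have holu: "(\<lambda>\<zeta>. u (w - \<beta> * \<zeta>)) holomorphic_on UNIV"
  proof -
    have "(\<lambda>\<zeta>. w - \<beta> * \<zeta>) holomorphic_on UNIV" by (intro holomorphic_intros)
    from holomorphic_on_compose_gen[OF this hol] show ?thesis by (simp add: o_def)
  qed
  have bdu: "norm (u (w - \<beta> * \<zeta>)) \<le> (C * exp (\<sigma> * \<bar>Im w\<bar>)) * exp (\<sigma> * \<bar>Im (\<beta> * \<zeta>)\<bar>)" for \<zeta>
  proof -
    have "\<bar>Im (w - \<beta> * \<zeta>)\<bar> \<le> \<bar>Im w\<bar> + \<bar>Im (\<beta> * \<zeta>)\<bar>" by simp
    then have "\<sigma> * \<bar>Im (w - \<beta> * \<zeta>)\<bar> \<le> \<sigma> * \<bar>Im w\<bar> + \<sigma> * \<bar>Im (\<beta> * \<zeta>)\<bar>"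
      using s by (simp flip: distrib_left del: minus_complex.sel times_complex.sel)
    then have "C * exp (\<sigma> * \<bar>Im (w - \<beta> * \<zeta>)\<bar>) \<le> C * (exp (\<sigma> * \<bar>Im w\<bar>) * exp (\<sigma> * \<bar>Im (\<beta> * \<zeta>)\<bar>))"
      using C0 by (intro mult_left_mono) (auto simp flip: exp_add)
    then show ?thesis using bd[of "w - \<beta> * \<zeta>"] by (simp add: mult.assoc)
  qed
  have all: "\<exists>\<zeta>. z = w - \<beta> * \<zeta>" using \<beta>0 by (intro exI[of _ "(w - z) / \<beta>"]) simp
  show ?thesis
  proof (cases "b \<in> \<real>")
    case True
    then obtain y where y: "\<beta> = of_real y" by (auto simp: \<beta>_def elim: Reals_cases)
    have ny: "\<bar>y\<bar> = norm b" using y by (metis \<beta>_def complex_mod_cnj norm_of_real)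
    have "u (w - \<beta> * \<zeta>) = 0" for \<zeta>
    proof (rule carlson_half_plane[OF holu, where z = \<zeta> and \<omega> = 1 and a = "\<sigma> * \<bar>y\<bar>"])
      show "\<sigma> * \<bar>y\<bar> < pi" using b True s by (simp add: ny field_simps)
      show "norm (u (w - \<beta> * \<zeta>)) \<le> (C * exp (\<sigma> * \<bar>Im w\<bar>)) * exp (\<sigma> * \<bar>y\<bar> * \<bar>Im \<zeta>\<bar>)" for \<zeta>
        using bdu[of \<zeta>] by (simp add: y abs_mult mult.assoc)
      show "u (w - \<beta> * of_nat n) = 0" for n using zero[of n] by (simp add: \<beta>_def mult.commute)
    qed auto
    then show ?thesis using all by auto
  next
    case False
    define t where "t = sgn (Im \<beta>)"
    have "Im \<beta> \<noteq> 0" using False by (simp add: \<beta>_def complex_is_Real_iff)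
    then have t: "t * Im \<beta> > 0" "\<bar>t\<bar> = 1" "t * t = 1" by (auto simp: t_def sgn_if)
    define \<omega> where "\<omega> = \<i> * of_real t * cnj \<beta> / of_real (norm \<beta>)"
    have n\<omega>: "norm \<omega> = 1" using t \<beta>0 by (simp add: \<omega>_def norm_mult norm_divide)
    have c\<omega>: "cnj \<omega> * \<zeta> = - \<i> * of_real (t / norm \<beta>) * (\<beta> * \<zeta>)" for \<zeta>
      by (simp add: \<omega>_def)
    have Re\<omega>: "Re (cnj \<omega> * \<zeta>) = t * Im (\<beta> * \<zeta>) / norm \<beta>" for \<zeta>
      unfolding c\<omega> by simp
    have "Re \<omega> = t * Im \<beta> / norm \<beta>" using Re\<omega>[of 1] by simp
    then have R\<omega>: "Re \<omega> > 0" using t(1) \<beta>0 by simp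
    define F where "F = (\<lambda>\<zeta>. u (w - \<beta> * \<zeta>) * exp (\<i> * of_real (t * \<sigma>) * (\<beta> * \<zeta>)))"
    have "F \<zeta> = 0" for \<zeta>
    proof (rule carlson_half_plane[OF _ n\<omega> R\<omega>, where F = F and z = \<zeta> and a = 0])
      show "F holomorphic_on UNIV" unfolding F_def using holu by (intro holomorphic_intros)
      show "norm (F \<zeta>) \<le> (C * exp (\<sigma> * \<bar>Im w\<bar>) * exp (2 * \<sigma> * norm \<beta>)) * exp (0 * \<bar>Im \<zeta>\<bar>)"
        if z: "Re (cnj \<omega> * \<zeta>) \<ge> - Re \<omega>" for \<zeta>
      proof -
        define v where "v = t * Im (\<beta> * \<zeta>)"
        have "Re \<omega> \<le> 1" using complex_Re_le_cmod[of \<omega>] n\<omega> by simp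
        then have "v / norm \<beta> \<ge> - 1" using z unfolding Re\<omega> v_def by linarith
        then have v1: "v \<ge> - norm \<beta>" using \<beta>0 by (simp add: field_simps)
        have av: "\<bar>Im (\<beta> * \<zeta>)\<bar> = \<bar>v\<bar>" unfolding v_def abs_mult t(2) by simp
        have "norm (exp (\<i> * of_real (t * \<sigma>) * (\<beta> * \<zeta>))) = exp (- \<sigma> * v)"
          by (simp add: v_def algebra_simps)
        then have "norm (F \<zeta>) = norm (u (w - \<beta> * \<zeta>)) * exp (- \<sigma> * v)"
          unfolding F_def norm_mult by (simp only:)
        also have "\<dots> \<le> (C * exp (\<sigma> * \<bar>Im w\<bar>)) * exp (\<sigma> * \<bar>v\<bar>) * exp (- \<sigma> * v)"
          by (intro mult_right_mono bdu[of \<zeta>, unfolded av] exp_ge_zero)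
        also have "\<dots> = (C * exp (\<sigma> * \<bar>Im w\<bar>)) * exp (\<sigma> * (\<bar>v\<bar> - v))"
          by (simp add: algebra_simps flip: exp_add)
        also have "\<dots> \<le> (C * exp (\<sigma> * \<bar>Im w\<bar>)) * exp (\<sigma> * (2 * norm \<beta>))"
        proof -
          have "\<bar>v\<bar> - v \<le> 2 * norm \<beta>" using v1 norm_ge_zero[of \<beta>] by linarith
          then have "\<sigma> * (\<bar>v\<bar> - v) \<le> \<sigma> * (2 * norm \<beta>)" using s by (intro mult_left_mono) auto
          then show ?thesis using C0 by (intro mult_left_mono) auto
        qed
        finally show ?thesis by (simp add: mult_ac)
      qed
      show "F (of_nat n) = 0" for n using zero[of n] by (simp add: F_def \<beta>_def mult.commute)
    qed auto
    then have "u (w - \<beta> * \<zeta>) = 0" for \<zeta> by (simp add: F_def)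
    then show ?thesis using all by auto
  qed
qed

section \<open>Hilbert space geometry and completeness\<close>

lemma paley_wiener_add_scaled:
  assumes f: "f \<in> paley_wiener \<sigma>" and g: "g \<in> paley_wiener \<sigma>"
  shows "(\<lambda>z. f z + c * g z) \<in> paley_wiener \<sigma>"
proof -
  note fD = paley_wienerD[OF f] and gD = paley_wienerD[OF g]
  have 1: "(\<lambda>z. f z + c * g z) holomorphic_on UNIV" using fD(1) gD(1) by (intro holomorphic_intros)
  have 2: "exp_type_le \<sigma> (\<lambda>z. f z + c * g z)"
    unfolding exp_type_le_def
  proof (intro allI impI)
    fix \<epsilon> :: real assume "\<epsilon> > 0"
    then obtain A B where A: "\<And>z. norm (f z) \<le> A * exp ((\<sigma> + \<epsilon>) * norm z)"
      and B: "\<And>z. norm (g z) \<le> B * exp ((\<sigma> + \<epsilon>) * norm z)"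
      using fD(2) gD(2) unfolding exp_type_le_def by blast
    have "norm (f z + c * g z) \<le> (A + norm c * B) * exp ((\<sigma> + \<epsilon>) * norm z)" for z
    proof -
      have "norm (f z + c * g z) \<le> norm (f z) + norm c * norm (g z)"
        using norm_triangle_ineq[of "f z" "c * g z"] by (simp add: norm_mult)
      also have "\<dots> \<le> A * exp ((\<sigma> + \<epsilon>) * norm z) + norm c * (B * exp ((\<sigma> + \<epsilon>) * norm z))"
        by (intro add_mono mult_left_mono A B) auto
      finally show ?thesis by (simp add: algebra_simps)
    qed
    then show "\<exists>C. \<forall>z. norm (f z + c * g z) \<le> C * exp ((\<sigma> + \<epsilon>) * norm z)" by blast
  qed
  have 3: "integrable lborel (\<lambda>t. (norm (f (complex_of_real t) + c * g (complex_of_real t)))\<^sup>2)"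
  proof (rule Bochner_Integration.integrable_bound)
    show "integrable lborel (\<lambda>t. 2 * (norm (f (complex_of_real t)))\<^sup>2 + 2 * (norm c)\<^sup>2 * (norm (g (complex_of_real t)))\<^sup>2)"
      using fD(3) gD(3) by simp
    show "(\<lambda>t. (norm (f (complex_of_real t) + c * g (complex_of_real t)))\<^sup>2) \<in> borel_measurable lborel"
      using fD(5) gD(5) by measurable
    have "(norm (x + c * y))\<^sup>2 \<le> 2 * (norm x)\<^sup>2 + 2 * (norm c)\<^sup>2 * (norm y)\<^sup>2" for x y :: complex
    proof -
      have "(norm (x + c * y))\<^sup>2 \<le> (norm x + norm c * norm y)\<^sup>2"
        using norm_triangle_ineq[of x "c * y"] by (intro power_mono) (auto simp: norm_mult)
      also have "\<dots> \<le> 2 * (norm x)\<^sup>2 + 2 * (norm c * norm y)\<^sup>2"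
        using sum_squares_bound[of "norm x" "norm c * norm y"] by (simp add: power2_sum)
      finally show ?thesis by (simp add: power_mult_distrib)
    qed
    then show "AE t in lborel. norm ((norm (f (complex_of_real t) + c * g (complex_of_real t)))\<^sup>2)
        \<le> norm (2 * (norm (f (complex_of_real t)))\<^sup>2 + 2 * (norm c)\<^sup>2 * (norm (g (complex_of_real t)))\<^sup>2)"
      by simp
  qed
  show ?thesis using 1 2 3 by (simp add: paley_wiener_def)
qed

lemma paley_wiener_0: "(\<lambda>z. 0) \<in> paley_wiener \<sigma>"
  by (auto simp: paley_wiener_def exp_type_le_def intro!: exI[of _ 0])

lemma paley_wiener_diff:
  assumes "f \<in> paley_wiener \<sigma>" "g \<in> paley_wiener \<sigma>"
  shows "(\<lambda>z. f z - g z) \<in> paley_wiener \<sigma>"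
  using paley_wiener_add_scaled[OF assms, of "-1"] by simp

lemma integrable_mult_cnj:
  assumes f: "f \<in> paley_wiener \<sigma>" and g: "g \<in> paley_wiener \<sigma>"
  shows "integrable lborel (\<lambda>t. f (complex_of_real t) * cnj (g (complex_of_real t)))"
proof (rule Bochner_Integration.integrable_bound)
  note fD = paley_wienerD[OF f] and gD = paley_wienerD[OF g]
  show "integrable lborel (\<lambda>t. (norm (f (complex_of_real t)))\<^sup>2 + (norm (g (complex_of_real t)))\<^sup>2)"
    using fD(3) gD(3) by simp
  show "(\<lambda>t. f (complex_of_real t) * cnj (g (complex_of_real t))) \<in> borel_measurable lborel"
    using borel_measurable_continuous_onI[OF continuous_on_mult[OF fD(4) continuous_on_cnj[OF gD(4)]]] by simp
  have "norm (x * cnj y) \<le> (norm x)\<^sup>2 + (norm y)\<^sup>2" for x y :: complex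
  proof -
    have "2 * norm x * norm y \<le> (norm x)\<^sup>2 + (norm y)\<^sup>2" by (rule sum_squares_bound)
    moreover have "0 \<le> norm x * norm y" by simp
    ultimately show ?thesis unfolding norm_mult complex_mod_cnj by linarith
  qed
  then show "AE t in lborel. norm (f (complex_of_real t) * cnj (g (complex_of_real t)))
      \<le> norm ((norm (f (complex_of_real t)))\<^sup>2 + (norm (g (complex_of_real t)))\<^sup>2)"
    by simp
qed

lemma pw_norm_sq_add_scaled:
  assumes f: "f \<in> paley_wiener \<sigma>" and g: "g \<in> paley_wiener \<sigma>"
  shows "(pw_norm (\<lambda>z. f z + c * g z))\<^sup>2 = (pw_norm f)\<^sup>2
    + 2 * Re (cnj c * (LINT t|lborel. f (complex_of_real t) * cnj (g (complex_of_real t)))) + (norm c)\<^sup>2 * (pw_norm g)\<^sup>2"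
proof -
  note fD = paley_wienerD[OF f] and gD = paley_wienerD[OF g]
  define h where "h = (\<lambda>t. cnj c * (f (complex_of_real t) * cnj (g (complex_of_real t))))"
  have h: "integrable lborel h" unfolding h_def using integrable_mult_cnj[OF f g] by simp
  have ptw: "(norm (x + c * y))\<^sup>2 = (norm x)\<^sup>2 + 2 * Re (cnj c * (x * cnj y)) + (norm c)\<^sup>2 * (norm y)\<^sup>2" for x y
    unfolding cmod_power2 by (simp add: power2_eq_square algebra_simps)
  have "(pw_norm (\<lambda>z. f z + c * g z))\<^sup>2 = (LINT t|lborel. (norm (f (complex_of_real t)))\<^sup>2
      + 2 * Re (h t) + (norm c)\<^sup>2 * (norm (g (complex_of_real t)))\<^sup>2)"
    unfolding pw_norm_sq ptw h_def ..
  also have "\<dots> = (pw_norm f)\<^sup>2 + 2 * Re (LINT t|lborel. h t) + (norm c)\<^sup>2 * (pw_norm g)\<^sup>2"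
    unfolding pw_norm_sq using fD(3) gD(3) h by simp
  finally show ?thesis by (simp add: h_def)
qed

lemma pw_norm_scaled: "pw_norm (\<lambda>z. c * f z) = norm c * pw_norm f"
  by (simp add: pw_norm_def norm_mult power_mult_distrib real_sqrt_mult)

lemma pw_parallelogram:
  assumes f: "f \<in> paley_wiener \<sigma>" and g: "g \<in> paley_wiener \<sigma>"
  shows "(pw_norm (\<lambda>z. f z - g z))\<^sup>2 = 2 * (pw_norm f)\<^sup>2 + 2 * (pw_norm g)\<^sup>2 - (pw_norm (\<lambda>z. f z + g z))\<^sup>2"
  using pw_norm_sq_add_scaled[OF f g, of 1] pw_norm_sq_add_scaled[OF f g, of "-1"] by simp

text \<open>The lemma of Fatou for the norm; it serves in place of completeness of the space.\<close>

lemma pw_norm_sq_le_liminf: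
  assumes v: "v \<in> paley_wiener \<sigma>" "\<And>m::nat. V m \<in> paley_wiener \<sigma>"
    and lim: "\<And>t::real. (\<lambda>m. V m (of_real t)) \<longlonglongrightarrow> v (of_real t)"
    and le: "\<And>m. (pw_norm (V m))\<^sup>2 \<le> a m" and a: "a \<longlonglongrightarrow> A"
  shows "(pw_norm v)\<^sup>2 \<le> A"
proof -
  have A0: "A \<ge> 0" using a le by (intro LIMSEQ_le_const[OF a]) (meson order_trans zero_le_power2)
  have eq: "ennreal ((pw_norm f)\<^sup>2) = (\<integral>\<^sup>+t. ennreal ((norm (f (complex_of_real t)))\<^sup>2) \<partial>lborel)"
    if "f \<in> paley_wiener \<sigma>" for f
    unfolding pw_norm_sq using paley_wienerD(3)[OF that] by (intro nn_integral_eq_integral[symmetric]) auto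
  have "ennreal ((pw_norm v)\<^sup>2) = (\<integral>\<^sup>+t. liminf (\<lambda>m. ennreal ((norm (V m (complex_of_real t)))\<^sup>2)) \<partial>lborel)"
    unfolding eq[OF v(1)]
  proof (rule nn_integral_cong)
    fix t :: real
    have "(\<lambda>m. ennreal ((norm (V m (complex_of_real t)))\<^sup>2)) \<longlonglongrightarrow> ennreal ((norm (v (complex_of_real t)))\<^sup>2)"
      by (intro tendsto_ennrealI tendsto_intros lim)
    then show "ennreal ((norm (v (complex_of_real t)))\<^sup>2) = liminf (\<lambda>m. ennreal ((norm (V m (complex_of_real t)))\<^sup>2))"
      by (intro lim_imp_Liminf[symmetric]) auto
  qed
  also have "\<dots> \<le> liminf (\<lambda>m. \<integral>\<^sup>+t. ennreal ((norm (V m (complex_of_real t)))\<^sup>2) \<partial>lborel)"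
  proof (rule nn_integral_liminf)
    fix m
    have [measurable]: "(\<lambda>t. V m (complex_of_real t)) \<in> borel_measurable borel"
      using paley_wienerD(5)[OF v(2)[of m]] by simp
    show "(\<lambda>t. ennreal ((norm (V m (complex_of_real t)))\<^sup>2)) \<in> borel_measurable lborel"
      by measurable
  qed
  also have "\<dots> = liminf (\<lambda>m. ennreal ((pw_norm (V m))\<^sup>2))" using eq[OF v(2)] by simp
  also have "\<dots> \<le> liminf (\<lambda>m. ennreal (a m))"
    by (intro Liminf_mono always_eventually allI ennreal_leI le)
  also have "\<dots> = ennreal A" by (intro lim_imp_Liminf tendsto_ennrealI a) auto
  finally show ?thesis using A0 by simp
qed

lemma fun_span_base: "g \<in> S \<Longrightarrow> g \<in> fun_span S"
  unfolding fun_span_def by (auto intro!: exI[of _ "{g}"] exI[of _ "\<lambda>_. 1"])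

lemma fun_span_lincomb:
  assumes "h1 \<in> fun_span S" "h2 \<in> fun_span S"
  shows "(\<lambda>z. a * h1 z + b * h2 z) \<in> fun_span S"
proof -
  obtain F1 c1 where 1: "finite F1" "F1 \<subseteq> S" "h1 = (\<lambda>z. \<Sum>g\<in>F1. c1 g * g z)" using assms(1) by (auto simp: fun_span_def)
  obtain F2 c2 where 2: "finite F2" "F2 \<subseteq> S" "h2 = (\<lambda>z. \<Sum>g\<in>F2. c2 g * g z)" using assms(2) by (auto simp: fun_span_def)
  define c where "c = (\<lambda>g. a * (if g \<in> F1 then c1 g else 0) + b * (if g \<in> F2 then c2 g else 0))"
  have "a * h1 z + b * h2 z = (\<Sum>g\<in>F1 \<union> F2. c g * g z)" for z
  proof -
    have "h1 z = (\<Sum>g\<in>F1 \<union> F2. (if g \<in> F1 then c1 g else 0) * g z)"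
      unfolding 1(3) using 1(1) 2(1) by (intro sum.mono_neutral_cong_left) auto
    moreover have "h2 z = (\<Sum>g\<in>F1 \<union> F2. (if g \<in> F2 then c2 g else 0) * g z)"
      unfolding 2(3) using 1(1) 2(1) by (intro sum.mono_neutral_cong_left) auto
    ultimately show ?thesis by (simp only: c_def sum_distrib_left sum.distrib distrib_right mult.assoc)
  qed
  then show ?thesis using 1 2 unfolding fun_span_def by (auto intro!: exI[of _ "F1 \<union> F2"] exI[of _ c])
qed

lemma fun_span_paley_wiener:
  assumes "S \<subseteq> paley_wiener \<sigma>"
  shows "fun_span S \<subseteq> paley_wiener \<sigma>"
proof
  fix h assume "h \<in> fun_span S"
  then obtain F c where F: "finite F" "F \<subseteq> S" "h = (\<lambda>z. \<Sum>g\<in>F. c g * g z)" by (auto simp: fun_span_def)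
  have "(\<lambda>z. \<Sum>g\<in>F. c g * g z) \<in> paley_wiener \<sigma>" using F(1,2)
  proof (induction F rule: finite_induct)
    case empty
    then show ?case using paley_wiener_0 by simp
  next
    case (insert g F)
    have "(\<lambda>z. (\<Sum>g\<in>F. c g * g z) + c g * g z) \<in> paley_wiener \<sigma>"
      using insert assms by (intro paley_wiener_add_scaled) auto
    then show ?case using insert by (simp add: add.commute)
  qed
  then show "h \<in> paley_wiener \<sigma>" using F by simp
qed

lemma pw_norm_kernel_pos:
  assumes "\<sigma> > 0"
  shows "pw_norm (pw_kernel \<sigma> w) > 0"
proof -
  have "norm (pw_kernel \<sigma> w (cnj w)) > 0" using assms by (simp add: pw_kernel_def)
  then have "pw_norm (pw_kernel \<sigma> w) * exp (\<sigma> * (\<bar>Im (cnj w)\<bar> + 1)) > 0"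
    using pw_point_bound[OF assms pw_kernel_mem[OF assms]] order_less_le_trans by blast
  then show ?thesis by (simp add: zero_less_mult_iff)
qed

text \<open>The optimal multiple of the kernel lowers the squared norm of \<open>u\<close> by
  \<open>(norm (u w))\<^sup>2 / (pw_norm (pw_kernel \<sigma> w))\<^sup>2\<close>, because \<open>u w\<close> is the inner product of \<open>u\<close> with the
  kernel.  If at most \<open>e\<close> can be gained, the value \<open>u w\<close> is small.\<close>

lemma nearly_minimal_small_value:
  assumes s: "\<sigma> > 0" and u: "u \<in> paley_wiener \<sigma>"
    and min: "\<And>c. d \<le> (pw_norm (\<lambda>z. u z + c * pw_kernel \<sigma> w z))\<^sup>2"
    and le: "(pw_norm u)\<^sup>2 \<le> d + e"
  shows "(norm (u w))\<^sup>2 \<le> e * (pw_norm (pw_kernel \<sigma> w))\<^sup>2"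
proof -
  define n where "n = (pw_norm (pw_kernel \<sigma> w))\<^sup>2"
  have n: "n > 0" unfolding n_def by (intro zero_less_power pw_norm_kernel_pos[OF s])
  define c where "c = - u w / of_real n"
  have "d \<le> (pw_norm u)\<^sup>2 + 2 * Re (cnj c * u w) + (norm c)\<^sup>2 * n"
    using min[of c] unfolding pw_norm_sq_add_scaled[OF u pw_kernel_mem[OF s]] pw_reproducing[OF s u] n_def .
  also have "cnj c * u w = - of_real ((norm (u w))\<^sup>2 / n)"
    unfolding c_def using complex_norm_square[of "u w"] by (simp add: mult.commute)
  also have "(norm c)\<^sup>2 * n = (norm (u w))\<^sup>2 / n"
    using n by (simp add: c_def norm_divide power_divide power2_eq_square)
  finally have "(norm (u w))\<^sup>2 / n \<le> e" using le by simp
  then show ?thesis using n by (simp add: n_def field_simps)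
qed

text \<open>The projection argument is carried out on a minimizing sequence: the limit of the \<open>u n\<close> vanishes on
  the progression and is therefore \<open>0\<close>, so that the Cauchy estimate for \<open>u n - u m\<close>, as \<open>m\<close> tends to
  infinity, bounds the norm of \<open>u n\<close> itself.\<close>

lemma kernel_progression_dense:
  assumes s: "\<sigma> > 0"
    and b: "b \<notin> \<real> \<or> (b \<in> \<real> \<and> 0 < norm b \<and> norm b < pi / \<sigma>)"
    and g: "g \<in> paley_wiener \<sigma>" and e: "\<epsilon> > 0"
  shows "\<exists>h\<in>fun_span (range (\<lambda>n::nat. pw_kernel \<sigma> (w - of_nat n * cnj b))). pw_norm (\<lambda>z. g z - h z) < \<epsilon>"
proof (rule ccontr)
  define S where "S = fun_span (range (\<lambda>n::nat. pw_kernel \<sigma> (w - of_nat n * cnj b)))"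
  assume "\<not> ?thesis"
  then have far: "pw_norm (\<lambda>z. g z - h z) \<ge> \<epsilon>" if "h \<in> S" for h using that by (auto simp: S_def not_less)
  have Spw: "S \<subseteq> paley_wiener \<sigma>" unfolding S_def using pw_kernel_mem[OF s] by (intro fun_span_paley_wiener) auto
  have kS: "pw_kernel \<sigma> (w - of_nat n * cnj b) \<in> S" for n :: nat unfolding S_def by (rule fun_span_base) auto
  define D where "D = (\<lambda>h. (pw_norm (\<lambda>z. g z - h z))\<^sup>2) ` S"
  have D0: "D \<noteq> {}" using kS by (auto simp: D_def)
  have Dbdd: "bdd_below D" by (auto simp: D_def intro!: bdd_belowI[of _ 0])
  define d where "d = Inf D"
  have dle: "d \<le> (pw_norm (\<lambda>z. g z - h z))\<^sup>2" if "h \<in> S" for h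
    unfolding d_def by (rule cInf_lower[OF _ Dbdd]) (use that in \<open>auto simp: D_def\<close>)
  have "\<epsilon>\<^sup>2 \<le> d" unfolding d_def
    by (rule cInf_greatest[OF D0]) (use far e in \<open>auto simp: D_def intro!: power_mono\<close>)
  then have d0: "d > 0" using e by (meson order_less_le_trans zero_less_power)
  have "\<exists>h\<in>S. (pw_norm (\<lambda>z. g z - h z))\<^sup>2 < d + 1 / real (Suc n)" for n
    using cInf_lessD[OF D0, of "d + 1 / real (Suc n)"] unfolding d_def[symmetric] by (auto simp: D_def)
  then obtain h where h: "\<And>n. h n \<in> S" "\<And>n. (pw_norm (\<lambda>z. g z - h n z))\<^sup>2 < d + 1 / real (Suc n)"
    by metis
  define u where "u = (\<lambda>n z. g z - h n z)"
  have upw: "u n \<in> paley_wiener \<sigma>" for n unfolding u_def using g h(1) Spw by (intro paley_wiener_diff) auto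
  have un: "(pw_norm (u n))\<^sup>2 \<le> d + 1 / real (Suc n)" for n using h(2)[of n] by (simp add: u_def)
  define \<delta> where "\<delta> = (\<lambda>n m. 2 / real (Suc n) + 2 / real (Suc m))"
  have dpw: "(\<lambda>z. u n z - u m z) \<in> paley_wiener \<sigma>" for n m using upw by (intro paley_wiener_diff)
  have cauchy: "(pw_norm (\<lambda>z. u n z - u m z))\<^sup>2 \<le> \<delta> n m" for n m
  proof -
    have mid: "(\<lambda>z. 1/2 * h n z + 1/2 * h m z) \<in> S" unfolding S_def using h(1) by (intro fun_span_lincomb) (auto simp: S_def)
    have "(\<lambda>z. u n z + u m z) = (\<lambda>z. 2 * (g z - (1/2 * h n z + 1/2 * h m z)))" by (simp add: u_def algebra_simps)
    then have "(pw_norm (\<lambda>z. u n z + u m z))\<^sup>2 = 4 * (pw_norm (\<lambda>z. g z - (1/2 * h n z + 1/2 * h m z)))\<^sup>2"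
      using pw_norm_scaled[of 2 "\<lambda>z. g z - (1/2 * h n z + 1/2 * h m z)"] by (simp add: power_mult_distrib)
    also have "\<dots> \<ge> 4 * d" using dle[OF mid] by simp
    finally show ?thesis using pw_parallelogram[OF upw upw, of n m] un[of n] un[of m] by (simp add: \<delta>_def)
  qed
  define E where "E = (\<lambda>z. exp (\<sigma> * (\<bar>Im z\<bar> + 1)))"
  have pc: "norm (u n z - u m z) \<le> sqrt (\<delta> n m) * E z" for n m z
  proof -
    have "pw_norm (\<lambda>z. u n z - u m z) \<le> sqrt (\<delta> n m)" using cauchy by (intro real_le_rsqrt)
    then have "pw_norm (\<lambda>z. u n z - u m z) * E z \<le> sqrt (\<delta> n m) * E z" by (intro mult_right_mono) (auto simp: E_def)
    from order_trans[OF pw_point_bound[OF s dpw[of n m], of z] this[unfolded E_def]]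
    show ?thesis by (simp add: E_def)
  qed
  define U where "U = (\<lambda>z. lim (\<lambda>n. u n z))"
  have Ulim: "(\<lambda>n. u n z) \<longlonglongrightarrow> U z" for z
  proof -
    have "Cauchy (\<lambda>n. u n z)"
    proof (rule metric_CauchyI)
      fix e :: real assume e: "e > 0"
      have "(\<lambda>N. sqrt (4 / real (Suc N)) * E z) \<longlonglongrightarrow> sqrt 0 * E z"
        by (intro tendsto_intros) real_asymp
      then have "eventually (\<lambda>N. sqrt (4 / real (Suc N)) * E z < e) sequentially"
        using e by (intro order_tendstoD) auto
      then obtain N where N: "sqrt (4 / real (Suc N)) * E z < e" by (auto simp: eventually_sequentially)
      have "dist (u m z) (u n z) < e" if "m \<ge> N" "n \<ge> N" for m n
      proof -
        have "2 / real (Suc m) \<le> 2 / real (Suc N)" "2 / real (Suc n) \<le> 2 / real (Suc N)"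
          using that by (auto intro!: divide_left_mono)
        then have "\<delta> m n \<le> 4 / real (Suc N)" by (simp add: \<delta>_def)
        then have "sqrt (\<delta> m n) * E z \<le> sqrt (4 / real (Suc N)) * E z" by (intro mult_right_mono) (auto simp: E_def)
        then show ?thesis using pc[of m z n] N by (simp add: dist_norm)
      qed
      then show "\<exists>N. \<forall>m\<ge>N. \<forall>n\<ge>N. dist (u m z) (u n z) < e" by blast
    qed
    then show ?thesis unfolding U_def by (simp add: Cauchy_convergent_iff convergent_LIMSEQ_iff)
  qed
  have \<delta>lim: "(\<lambda>m. \<delta> n m) \<longlonglongrightarrow> 2 / real (Suc n)" for n unfolding \<delta>_def by real_asymp
  have uU: "norm (u n z - U z) \<le> sqrt (2 / real (Suc n)) * E z" for n z
  proof (rule LIMSEQ_le)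
    show "(\<lambda>m. norm (u n z - u m z)) \<longlonglongrightarrow> norm (u n z - U z)" by (intro tendsto_intros Ulim)
    show "(\<lambda>m. sqrt (\<delta> n m) * E z) \<longlonglongrightarrow> sqrt (2 / real (Suc n)) * E z" by (intro tendsto_intros \<delta>lim)
  qed (use pc in auto)
  have holU: "U holomorphic_on UNIV"
  proof (rule holomorphic_uniform_sequence[OF open_UNIV])
    show "u n holomorphic_on UNIV" for n using paley_wienerD(1)[OF upw] .
    fix x :: complex
    have "uniform_limit (cball x 1) u U sequentially"
    proof (rule uniform_limitI)
      fix e :: real assume e: "e > 0"
      define B where "B = exp (\<sigma> * (\<bar>Im x\<bar> + 2))"
      have EB: "E z \<le> B" if "z \<in> cball x 1" for z
      proof -
        have "\<bar>Im x - Im z\<bar> \<le> 1" using that abs_Im_le_cmod[of "x - z"] by (simp add: dist_norm)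
        then show ?thesis using s by (simp add: E_def B_def)
      qed
      have "(\<lambda>n. sqrt (2 / real (Suc n)) * B) \<longlonglongrightarrow> sqrt 0 * B" by (intro tendsto_intros) real_asymp
      then have "eventually (\<lambda>n. sqrt (2 / real (Suc n)) * B < e) sequentially"
        using e by (intro order_tendstoD) auto
      then show "\<forall>\<^sub>F n in sequentially. \<forall>z\<in>cball x 1. dist (u n z) (U z) < e"
      proof eventually_elim
        case (elim n)
        show ?case
        proof
          fix z assume "z \<in> cball x 1"
          then have "sqrt (2 / real (Suc n)) * E z \<le> sqrt (2 / real (Suc n)) * B" by (intro mult_left_mono EB) auto
          then show "dist (u n z) (U z) < e" unfolding dist_norm using uU[of n z] elim by linarith
        qed
      qed
    qed
    then show "\<exists>d>0. cball x d \<subseteq> UNIV \<and> uniform_limit (cball x d) u U sequentially"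
      by (intro exI[of _ 1]) auto
  qed
  have Ubd: "norm (U z) \<le> ((pw_norm (u 0) + sqrt 2) * exp \<sigma>) * exp (\<sigma> * \<bar>Im z\<bar>)" for z
  proof -
    have "norm (U z) \<le> norm (u 0 z) + norm (u 0 z - U z)" using norm_triangle_ineq4[of "u 0 z" "u 0 z - U z"] by simp
    also have "\<dots> \<le> pw_norm (u 0) * E z + sqrt 2 * E z"
      using pw_point_bound[OF s upw[of 0], of z] uU[of 0 z] by (simp add: E_def)
    finally show ?thesis by (simp add: E_def algebra_simps exp_add)
  qed
  have Uzero: "U (w - of_nat j * cnj b) = 0" for j :: nat
  proof -
    define v where "v = w - of_nat j * cnj b"
    define K where "K = (pw_norm (pw_kernel \<sigma> v))\<^sup>2"
    have "(norm (u n v))\<^sup>2 \<le> 1 / real (Suc n) * K" for n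
      unfolding K_def
    proof (rule nearly_minimal_small_value[OF s upw _ un])
      fix c
      have "(\<lambda>z. 1 * h n z + (- c) * pw_kernel \<sigma> v z) \<in> S"
        unfolding S_def using h(1) kS[of j] by (intro fun_span_lincomb) (auto simp: S_def v_def)
      from dle[OF this] show "d \<le> (pw_norm (\<lambda>z. u n z + c * pw_kernel \<sigma> v z))\<^sup>2"
        by (simp add: u_def algebra_simps)
    qed
    moreover have "(\<lambda>n. 1 / real (Suc n) * K) \<longlonglongrightarrow> 0" by real_asymp
    moreover have "(\<lambda>n. (norm (u n v))\<^sup>2) \<longlonglongrightarrow> (norm (U v))\<^sup>2" by (intro tendsto_intros Ulim)
    ultimately have "(norm (U v))\<^sup>2 \<le> 0" by (meson LIMSEQ_le)
    then show ?thesis by (simp add: v_def)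
  qed
  have U0: "U z = 0" for z by (rule entire_eq_0_of_progression[OF holU s Ubd b Uzero])
  have small: "d \<le> 2 / real (Suc n)" for n
  proof -
    have "(pw_norm (u n))\<^sup>2 \<le> 2 / real (Suc n)"
    proof (rule pw_norm_sq_le_liminf[OF upw dpw _ cauchy \<delta>lim])
      show "(\<lambda>m. u n (of_real t) - u m (of_real t)) \<longlonglongrightarrow> u n (of_real t)" for t
        using tendsto_diff[OF tendsto_const Ulim[of "of_real t"], of "u n (of_real t)"] by (simp add: U0)
    qed
    then show ?thesis using dle[OF h(1)[of n]] by (simp add: u_def)
  qed
  have "(\<lambda>n. 2 / real (Suc n)) \<longlonglongrightarrow> 0" by real_asymp
  then have "d \<le> 0" using small by (intro LIMSEQ_le_const) auto
  then show False using d0 by simp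
qed

section \<open>Cyclicity of kernels under translation\<close>

lemma comp_op_translation_power_kernel:
  "(comp_op (\<lambda>z. z + b) ^^ n) (pw_kernel \<sigma> w) = pw_kernel \<sigma> (w - of_nat n * cnj b)"
  by (simp add: comp_op_translation_power pw_kernel_translate)

text \<open>The two points differ by \<open>(n + 1) * b\<close>, and \<open>\<sigma> * (n + 1) * b\<close> is a nonzero multiple of \<open>pi\<close>.\<close>

lemma pw_kernel_critical_zero:
  assumes s: "\<sigma> > 0" and b: "b \<in> \<real>" "norm b = pi / \<sigma>"
  shows "pw_kernel \<sigma> (w - of_nat n * cnj b) (cnj w + b) = 0"
proof -
  obtain y where y: "b = of_real y" using b(1) by (auto elim: Reals_cases)
  have y0: "y \<noteq> 0" using b(2) y s by auto
  have e: "cnj w + b - cnj (w - of_nat n * cnj b) = of_nat (Suc n) * of_real y" by (simp add: y algebra_simps)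
  then have ne: "cnj w + b \<noteq> cnj (w - of_nat n * cnj b)" using y0
    by (metis eq_iff_diff_eq_0 mult_eq_0_iff of_nat_eq_0_iff of_real_eq_0_iff nat.distinct(2))
  have "\<bar>\<sigma> * y\<bar> = pi" using b(2) y s by (simp add: abs_mult)
  then have "\<sigma> * y = pi \<or> \<sigma> * y = - pi" by linarith
  then have "sin (real (Suc n) * (\<sigma> * y)) = 0"
    using sin_npi[of "Suc n"] by auto
  then have "sin (of_real \<sigma> * (of_nat (Suc n) * of_real y) :: complex) = 0"
    by (metis (no_types, opaque_lifting) mult.left_commute of_real_0 of_real_mult of_real_of_nat_eq sin_of_real)
  then show ?thesis unfolding pw_kernel_def using ne by (simp only: e if_False) simp
qed

theorem theorem3p4:
  fixes \<sigma> :: real and b :: complex and \<phi> :: "complex \<Rightarrow> complex"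
  assumes "\<sigma> > 0"
    and "\<phi> = (\<lambda>z. z + b)"
  shows "(b \<notin> \<real> \<or> (b \<in> \<real> \<and> 0 < norm b \<and> norm b < pi / \<sigma>) \<longrightarrow>
            (\<forall>w. pw_cyclic \<sigma> (comp_op \<phi>) (pw_kernel \<sigma> w)))
       \<and> (b \<in> \<real> \<and> norm b = pi / \<sigma> \<longrightarrow>
            (\<forall>w. \<not> pw_cyclic \<sigma> (comp_op \<phi>) (pw_kernel \<sigma> w)))"
proof (intro conjI impI allI)
  note s = assms(1)
  have orbit: "range (\<lambda>n. (comp_op \<phi> ^^ n) (pw_kernel \<sigma> w)) = range (\<lambda>n. pw_kernel \<sigma> (w - of_nat n * cnj b))" for w
    by (simp only: assms(2) comp_op_translation_power_kernel)
  show "pw_cyclic \<sigma> (comp_op \<phi>) (pw_kernel \<sigma> w)"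
    if "b \<notin> \<real> \<or> (b \<in> \<real> \<and> 0 < norm b \<and> norm b < pi / \<sigma>)" for w
    unfolding pw_cyclic_def orbit using kernel_progression_dense[OF s that] pw_kernel_mem[OF s] by blast
  show "\<not> pw_cyclic \<sigma> (comp_op \<phi>) (pw_kernel \<sigma> w)" if b: "b \<in> \<real> \<and> norm b = pi / \<sigma>" for w
  proof
    \<comment> \<open>All of the span vanishes at \<open>v\<close>, whereas the kernel \<open>k\<close> has the value \<open>\<sigma> / pi\<close> there;
      \<open>\<epsilon>\<close> is that value divided by the norm bound for evaluation at \<open>v\<close>.\<close>
    define v where "v = cnj w + b"
    define k where "k = pw_kernel \<sigma> (cnj v)"
    define \<epsilon> where "\<epsilon> = \<sigma> / pi * exp (- \<sigma> * (\<bar>Im v\<bar> + 1))"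
    have kpw: "k \<in> paley_wiener \<sigma>" unfolding k_def by (rule pw_kernel_mem[OF s])
    assume "pw_cyclic \<sigma> (comp_op \<phi>) (pw_kernel \<sigma> w)"
    moreover have "\<epsilon> > 0" using s by (simp add: \<epsilon>_def)
    ultimately obtain h where h: "h \<in> fun_span (range (\<lambda>n. pw_kernel \<sigma> (w - of_nat n * cnj b)))"
      "pw_norm (\<lambda>z. k z - h z) < \<epsilon>"
      unfolding pw_cyclic_def orbit using kpw by blast
    have hpw: "h \<in> paley_wiener \<sigma>"
      using h(1) fun_span_paley_wiener[of "range (\<lambda>n. pw_kernel \<sigma> (w - of_nat n * cnj b))" \<sigma>] pw_kernel_mem[OF s] by auto
    have "h v = 0"
    proof -
      obtain F c where "F \<subseteq> range (\<lambda>n. pw_kernel \<sigma> (w - of_nat n * cnj b))" "h = (\<lambda>z. \<Sum>g\<in>F. c g * g z)"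
        using h(1) by (auto simp: fun_span_def)
      then show ?thesis using pw_kernel_critical_zero[OF s, of b w] b by (auto simp: v_def intro!: sum.neutral)
    qed
    moreover have "k v = of_real (\<sigma> / pi)" by (simp add: k_def pw_kernel_def)
    ultimately have "\<sigma> / pi \<le> pw_norm (\<lambda>z. k z - h z) * exp (\<sigma> * (\<bar>Im v\<bar> + 1))"
      using pw_point_bound[OF s paley_wiener_diff[OF kpw hpw], of v] s by (simp add: norm_divide)
    also have "\<dots> < \<epsilon> * exp (\<sigma> * (\<bar>Im v\<bar> + 1))" using h(2) by (intro mult_strict_right_mono) auto
    also have "\<dots> = \<sigma> / pi" by (simp add: \<epsilon>_def mult.assoc flip: exp_add)
    finally show False by simp
  qed
qed

end
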